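(* Let $\mathcal{O}\subset\mathbb{R}^d$ be a domain (connected open subset) and let $Au=-\operatorname{tr}(aD^2u)-\langle b,Du\rangle+cu$. Suppose that: - $\lambda_*>0$ on $\mathcal{O}$; - $b^\perp>0$ on $\partial_0\mathcal{O}$; - $c\ge 0$ on $\mathcal{O}$ and $c\ge 0$ on $\partial_0\mathcal{O}$; - $b$ is locally bounded on $\mathcal{O}$ and $c$ is locally bounded on $\underline{\mathcal{O}}$; - $b$ is continuous along $\partial_0\mathcal{O}$, i.e. $b\in C(\partial_0\mathcal{O};\mathbb{R}^d)$; - $\partial_0\mathcal{O}$ is $C^{1,\alpha}$ for some $\alpha\in(0,1)$. If $u\in C^2_s(\underline{\mathcal{O}})$ obeys $Au\le 0$ on $\mathcal{O}$, then the following hold. 1. If $c=0$ on $\underline{\mathcal{O}}$ and $u$ attains a global maximum in $\underline{\mathcal{O}}$, then $u$ is constant on $\mathcal{O}$. 2. If $c\ge 0$ on $\underline{\mathcal{O}}$ and $u$ attains a non-negative global maximum in $\underline{\mathcal{O}}$, then $u$ is constant on $\mathcal{O}$.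
   Context: The coefficients are everywhere-defined: $a:\mathcal{O}\to\mathscr{S}^+(d)$ (non-negative definite symmetric real $d\times d$ matrices), $b$ is $\mathbb{R}^d$-valued, $c$ is real-valued, with $b,c$ also defined on $\partial_0\mathcal{O}$. $\lambda(x)$ is the smallest eigenvalue of $a(x)$ and $\lambda_*$ is the lower semicontinuous envelope of $\lambda$ on $\mathcal{O}$. Degenerate boundary: $\partial_0\mathcal{O}:=\operatorname{int}\{x\in\partial\mathcal{O}:\lim_{\mathcal{O}\ni x'\to x}a(x')=0\}$ (interior relative to $\partial\mathcal{O}$), and $\underline{\mathcal{O}}:=\mathcal{O}\cup\partial_0\mathcal{O}$. $\vec n$ is the inward-pointing unit normal vector field along $\partial_0\mathcal{O}$ (extended to a tubular neighborhood in $\underline{\mathcal{O}}$) and $b^\perp:=\langle b,\vec n\rangle$. The condition that $b$ is continuous along $\partial_0\mathcal{O}$ is understood as continuity of $b$, as a function on $\underline{\mathcal O}$, at the points of $\partial_0\mathcal{O}$. $C^2_s(\underline{\mathcal{O}})$ is the set of $u\in C^2(\mathcal{O})\cap C^1(\underline{\mathcal{O}})$ such that $\operatorname{tr}(aD^2u)$ extends to a continuous function on $\underline{\mathcal{O}}$ and this extension is $0$ on $\partial_0\mathcal{O}$.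
   Formalization: The formal theorem also assumes that a is locally bounded on O; without this the claim fails, e.g. for a=diag(1,6/x²) (a=I where x=0), b=c=0, u=−x⁴(1−y²) on (−1,1)². *)

theory Defs
  imports "HOL-Analysis.Analysis"
begin

text \<open>Throughout, \<open>S\<close> is an open subset of Euclidean space, \<open>a\<close>, \<open>b\<close>, \<open>c\<close> are
  everywhere-defined coefficient functions, and only their values on \<open>S\<close>
  (for \<open>b\<close>, \<open>c\<close> also on the degenerate boundary) matter.

  Besides local boundedness of \<open>b\<close> and \<open>c\<close>, the strong maximum principle needs local boundedness
  of \<open>a\<close> on \<open>S\<close>. Without it, \<open>u(x,y) = - x\<^sup>4 (1 - y\<^sup>2)\<close> on the square \<open>(-1,1)\<^sup>2\<close>, with
  \<open>b = 0\<close>, \<open>c = 0\<close> and \<open>a = diag(1, 6/x\<^sup>2)\<close> (\<open>a\<close> the identity matrix where \<open>x = 0\<close>), is a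
  counterexample: the smallest eigenvalue of \<open>a\<close> is 1 and \<open>tr(a D\<^sup>2u) = 12 x\<^sup>2 y\<^sup>2\<close>, but \<open>u\<close>
  attains its maximum 0 and is not constant.\<close>

definition nonneg_definite_symmetric :: "real^'n^'n \<Rightarrow> bool" where
  "nonneg_definite_symmetric M \<longleftrightarrow> transpose M = M \<and> (\<forall>v. 0 \<le> v \<bullet> (M *v v))"

definition smallest_eigenvalue :: "real^'n^'n \<Rightarrow> real" where
  "smallest_eigenvalue M = (LEAST l. \<exists>v. v \<noteq> 0 \<and> M *v v = l *\<^sub>R v)"

text \<open>The filter below does not puncture the neighbourhoods of \<open>x\<close>: for \<open>x \<in> S\<close> the value is
  the supremum over \<open>r > 0\<close> of the infimum of \<open>f\<close> on \<open>S \<inter> ball x r\<close>, so it is at most \<open>f x\<close>.\<close>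

definition lsc_envelope :: "('a::topological_space) set \<Rightarrow> ('a \<Rightarrow> real) \<Rightarrow> 'a \<Rightarrow> ereal" where
  "lsc_envelope S f x = Liminf (inf (nhds x) (principal S)) (\<lambda>y. ereal (f y))"

definition locally_bounded_on ::
    "('a::metric_space) set \<Rightarrow> ('a \<Rightarrow> 'b::metric_space) \<Rightarrow> bool" where
  "locally_bounded_on S f \<longleftrightarrow> (\<forall>x\<in>S. \<exists>r>0. bounded (f ` (S \<inter> ball x r)))"

definition degenerate_boundary ::
    "(real^'n) set \<Rightarrow> (real^'n \<Rightarrow> real^'n^'n) \<Rightarrow> (real^'n) set" where
  "degenerate_boundary S a =
     (top_of_set (frontier S)) interior_of {x \<in> frontier S. (a \<longlongrightarrow> 0) (at x within S)}"

definition domain_with_boundary ::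
    "(real^'n) set \<Rightarrow> (real^'n \<Rightarrow> real^'n^'n) \<Rightarrow> (real^'n) set" where
  "domain_with_boundary S a = S \<union> degenerate_boundary S a"

text \<open>The inward-pointing unit normal: the unit vector that is orthogonal to the velocities of all
  curves in the boundary through \<open>x\<close> and points into \<open>S\<close>. It exists and is unique at the points of
  a boundary portion of class \<open>C\<^sup>1\<^sup>,\<^sup>\<alpha>\<close>.\<close>

definition tangent_vectors :: "(real^'n) set \<Rightarrow> real^'n \<Rightarrow> (real^'n) set" where
  "tangent_vectors S x =
     {v. \<exists>\<gamma>. \<gamma> 0 = x \<and> (\<forall>\<^sub>F t in at (0::real). \<gamma> t \<in> frontier S) \<and>
             (\<gamma> has_vector_derivative v) (at 0)}"

definition inward_unit_normal :: "(real^'n) set \<Rightarrow> real^'n \<Rightarrow> real^'n" where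
  "inward_unit_normal S x =
     (THE n. norm n = 1 \<and> (\<forall>v\<in>tangent_vectors S x. v \<bullet> n = 0) \<and>
             (\<forall>\<^sub>F t in at_right (0::real). x + t *\<^sub>R n \<in> S))"

definition normal_component :: "(real^'n) set \<Rightarrow> (real^'n \<Rightarrow> real^'n) \<Rightarrow> real^'n \<Rightarrow> real" where
  "normal_component S b x = b x \<bullet> inward_unit_normal S x"

text \<open>Boundary portions of class \<open>C\<^sup>1\<^sup>,\<^sup>\<alpha>\<close> are understood in the sense of Gilbarg and Trudinger
  (Section 6.2), that is, through local diffeomorphisms that flatten the boundary. As there,
  \<open>C\<^sup>1\<^sup>,\<^sup>\<alpha>\<close> on an open set means that the first derivatives are locally Hoelder continuous.\<close>

definition locally_Hoelder_on ::
    "real \<Rightarrow> ('a::metric_space) set \<Rightarrow> ('a \<Rightarrow> 'b::metric_space) \<Rightarrow> bool" where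
  "locally_Hoelder_on \<alpha> U f \<longleftrightarrow>
     (\<forall>K. compact K \<and> K \<subseteq> U \<longrightarrow>
        (\<exists>C. \<forall>x\<in>K. \<forall>y\<in>K. dist (f x) (f y) \<le> C * dist x y powr \<alpha>))"

definition C1_Hoelder_on :: "real \<Rightarrow> (real^'n) set \<Rightarrow> (real^'n \<Rightarrow> real^'m) \<Rightarrow> bool" where
  "C1_Hoelder_on \<alpha> U f \<longleftrightarrow>
     (\<forall>x\<in>U. f differentiable (at x)) \<and> locally_Hoelder_on \<alpha> U (\<lambda>x. jacobian f (at x))"

definition C1_Hoelder_boundary_portion ::
    "real \<Rightarrow> (real^'n) set \<Rightarrow> (real^'n) set \<Rightarrow> bool" where
  "C1_Hoelder_boundary_portion \<alpha> S T \<longleftrightarrow>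
     T \<subseteq> frontier S \<and>
     (\<forall>x\<in>T. \<exists>r>0. \<exists>\<psi>::real^'n \<Rightarrow> real^'n. \<exists>k.
        let B = ball x r in
          inj_on \<psi> B \<and> open (\<psi> ` B) \<and>
          \<psi> ` (B \<inter> S) \<subseteq> {y. y $ k > 0} \<and>
          \<psi> ` (B \<inter> frontier S) \<subseteq> {y. y $ k = 0} \<and>
          C1_Hoelder_on \<alpha> B \<psi> \<and>
          C1_Hoelder_on \<alpha> (\<psi> ` B) (the_inv_into B \<psi>) \<and>
          B \<inter> frontier S \<subseteq> T)"

definition grad :: "(real^'n \<Rightarrow> real) \<Rightarrow> real^'n \<Rightarrow> real^'n" where
  "grad u x = (\<chi> i. frechet_derivative u (at x) (axis i 1))"

definition hessian :: "(real^'n \<Rightarrow> real) \<Rightarrow> real^'n \<Rightarrow> real^'n^'n" where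
  "hessian u x = jacobian (grad u) (at x)"

definition C2_on :: "(real^'n) set \<Rightarrow> (real^'n \<Rightarrow> real) \<Rightarrow> bool" where
  "C2_on S u \<longleftrightarrow>
     (\<forall>x\<in>S. u differentiable (at x)) \<and> continuous_on S (grad u) \<and>
     (\<forall>x\<in>S. grad u differentiable (at x)) \<and> continuous_on S (hessian u)"

text \<open>For \<open>S \<subseteq> S' \<subseteq> closure S\<close>: the function and its first derivatives on \<open>S\<close> extend
  continuously to \<open>S'\<close>.\<close>

definition C1_up_to :: "(real^'n) set \<Rightarrow> (real^'n) set \<Rightarrow> (real^'n \<Rightarrow> real) \<Rightarrow> bool" where
  "C1_up_to S S' u \<longleftrightarrow>
     (\<forall>x\<in>S. u differentiable (at x)) \<and> continuous_on S' u \<and>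
     (\<exists>g. continuous_on S' g \<and> (\<forall>x\<in>S. g x = grad u x))"

definition C2s :: "(real^'n) set \<Rightarrow> (real^'n \<Rightarrow> real^'n^'n) \<Rightarrow> (real^'n \<Rightarrow> real) set" where
  "C2s S a = {u. C2_on S u \<and> C1_up_to S (domain_with_boundary S a) u \<and>
     (\<exists>h. continuous_on (domain_with_boundary S a) h \<and>
          (\<forall>x\<in>S. h x = trace (a x ** hessian u x)) \<and>
          (\<forall>x\<in>degenerate_boundary S a. h x = 0))}"

definition elliptic_op ::
    "(real^'n \<Rightarrow> real^'n^'n) \<Rightarrow> (real^'n \<Rightarrow> real^'n) \<Rightarrow> (real^'n \<Rightarrow> real) \<Rightarrow>
     (real^'n \<Rightarrow> real) \<Rightarrow> real^'n \<Rightarrow> real" where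
  "elliptic_op a b c u x = - trace (a x ** hessian u x) - b x \<bullet> grad u x + c x * u x"

end

theory Submission
  imports Defs
begin

text \<open>
  Let \<open>M\<close> be the global maximum of \<open>u\<close>. In both cases of the theorem \<open>c M \<ge> 0\<close>, so that
  \<open>tr (a D\<^sup>2u) + b \<bullet> Du - c (u - M) \<ge> 0\<close> on \<open>S\<close>, and it remains to show two things: if \<open>u\<close> equals \<open>M\<close>
  somewhere in \<open>S\<close>, then everywhere (\<open>interior_strong_maximum_principle\<close>); and \<open>u\<close> cannot equal \<open>M\<close>
  on the degenerate boundary without doing so in \<open>S\<close> (\<open>no_maximum_on_degenerate_boundary\<close>).

  Both follow from one perturbation argument. Suppose \<open>u z = M\<close>, and let \<open>w\<close> be a quadratic
  function with \<open>w z = 0\<close>. The maximisers of \<open>u + \<epsilon> w\<close> on a compact neighbourhood of \<open>z\<close> approach,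
  as \<open>\<epsilon>\<close> tends to 0, a point \<open>q\<close> with \<open>u q = M\<close> and \<open>w q \<ge> 0\<close> (\<open>perturbed_maximum_near_contact\<close>).
  If \<open>w\<close> is a strict subsolution near \<open>q\<close>, no such maximiser can exist near \<open>q\<close>. At a maximiser in
  \<open>S\<close> this is the second derivative test (\<open>no_maximum_of_strict_perturbation\<close>). At a
  maximiser on the degenerate boundary the equation itself acts as a boundary condition: as
  \<open>tr (a D\<^sup>2u)\<close> vanishes there, it becomes an inequality for the derivative along \<open>b\<close>, and \<open>b\<close> points into \<open>S\<close>
  (\<open>no_boundary_maximum_of_strict_perturbation\<close>).

  In the interior, \<open>z\<close> is a point of the set \<open>u = M\<close> touched by a ball on which \<open>u < M\<close>, and
  ellipticity lets \<open>w\<close> be a strict subsolution that is nonnegative, near \<open>z\<close>, only in the ball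
  and at \<open>z\<close>; so \<open>q = z\<close>. At the degenerate boundary, the strictness of \<open>w\<close> comes from \<open>b\<close>: the
  gradient of \<open>w\<close> is close to the inward normal, and \<open>a\<close> is negligible near \<open>q\<close>. The
  differentiable flattening of the boundary keeps \<open>q\<close> away from the edge of the neighbourhood.
\<close>

section \<open>Semidefinite matrices\<close>

lemma symmetric_form:
  assumes "transpose (A::real^'n^'n) = A"
  shows "x \<bullet> (A *v y) = y \<bullet> (A *v x)"
  by (metis assms dot_lmul_matrix inner_commute transpose_matrix_vector)

lemma semidefinite_Cauchy_Schwarz:
  assumes A: "nonneg_definite_symmetric (A::real^'n^'n)"
  shows "(x \<bullet> (A *v y))\<^sup>2 \<le> (x \<bullet> (A *v x)) * (y \<bullet> (A *v y))"
proof -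
  have sym: "y \<bullet> (A *v x) = x \<bullet> (A *v y)"
    using A symmetric_form unfolding nonneg_definite_symmetric_def by metis
  define p q s where "p = x \<bullet> (A *v x)" and "q = x \<bullet> (A *v y)" and "s = y \<bullet> (A *v y)"
  have quad: "0 \<le> \<alpha>\<^sup>2 * p + 2 * \<alpha> * \<beta> * q + \<beta>\<^sup>2 * s" for \<alpha> \<beta>
  proof -
    have "0 \<le> (\<alpha> *\<^sub>R x + \<beta> *\<^sub>R y) \<bullet> (A *v (\<alpha> *\<^sub>R x + \<beta> *\<^sub>R y))"
      using A unfolding nonneg_definite_symmetric_def by blast
    also have "\<dots> = \<alpha>\<^sup>2 * p + 2 * \<alpha> * \<beta> * q + \<beta>\<^sup>2 * s"
      unfolding p_def q_def s_def
      by (simp add: matrix_vector_right_distrib matrix_vector_mult_scaleR inner_add_left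
          inner_add_right sym power2_eq_square algebra_simps)
    finally show ?thesis .
  qed
  have "0 \<le> p" "0 \<le> s" using quad[of 1 0] quad[of 0 1] by auto
  have "q\<^sup>2 \<le> p * s"
  proof (cases "s = 0")
    case False
    with \<open>0 \<le> s\<close> have "0 < s" by simp
    have "0 \<le> s * (p * s - q\<^sup>2)"
      using quad[of s "- q"] by (simp add: power2_eq_square algebra_simps)
    with \<open>0 < s\<close> show ?thesis by (simp add: zero_le_mult_iff)
  next
    case True
    have "0 \<le> p + 2 * \<beta> * q" for \<beta> using quad[of 1 \<beta>] True by simp
    from this[of "- (p + 1) / q"] have "q = 0"
      using \<open>0 \<le> p\<close> by (cases "q = 0") (auto simp: divide_simps)
    then show ?thesis using True by simp
  qed
  then show ?thesis unfolding p_def q_def s_def .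
qed

lemma trace_mult_rank_one:
  fixes y :: "real^'n" and H :: "real^'n^'n"
  shows "trace ((\<chi> i j. y $ i * y $ j) ** H) = y \<bullet> (H *v y)"
proof -
  have "trace ((\<chi> i j. y $ i * y $ j) ** H) = (\<Sum>i\<in>UNIV. \<Sum>k\<in>UNIV. y$i * y$k * H$k$i)"
    by (simp add: trace_def matrix_matrix_mult_def)
  also have "\<dots> = (\<Sum>k\<in>UNIV. \<Sum>i\<in>UNIV. y$i * y$k * H$k$i)"
    by (rule sum.swap)
  also have "\<dots> = y \<bullet> (H *v y)"
    by (simp add: inner_vec_def matrix_vector_mult_def sum_distrib_left algebra_simps)
  finally show ?thesis .
qed

lemma rank_one_mult_vector:
  fixes y x :: "real^'n"
  shows "(\<chi> i j. y $ i * y $ j) *v x = (y \<bullet> x) *\<^sub>R y"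
  by (simp add: vec_eq_iff matrix_vector_mult_def inner_vec_def sum_distrib_left mult_ac)

lemma trace_mult_linear_left:
  fixes A B H :: "real^'n^'n"
  shows "trace ((A + r *\<^sub>R B) ** H) = trace (A ** H) + r * trace (B ** H)"
  by (simp add: trace_def matrix_matrix_mult_def sum.distrib sum_distrib_left algebra_simps)

text \<open>Subtracting from \<open>A\<close> the rank-one matrix \<open>y y\<^sup>T / (e \<bullet> y)\<close>, where \<open>y = A e\<close> for a basis vector
  \<open>e\<close> with \<open>A e \<noteq> 0\<close>, is a step of Cholesky elimination: by Cauchy-Schwarz the rest is again
  semidefinite, and it annihilates \<open>e\<close> and every vector annihilated by \<open>A\<close>. So \<open>A\<close> is a nonnegative
  combination of matrices \<open>y y\<^sup>T\<close>, for which the trace against \<open>H\<close> is \<open>y \<bullet> H y\<close>.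
  In this form the lemma applies to Hessians without recourse to the symmetry of second derivatives.\<close>
lemma trace_mult_semidefinite_nonneg:
  fixes A H :: "real^'n^'n"
  assumes "nonneg_definite_symmetric A" and H: "\<And>v. 0 \<le> v \<bullet> (H *v v)"
  shows "0 \<le> trace (A ** H)"
  using assms(1)
proof (induction "card {i. A *v axis i 1 \<noteq> 0}" arbitrary: A rule: less_induct)
  case less
  note A = less.prems
  show ?case
  proof (cases "{i. A *v axis i 1 \<noteq> 0} = {}")
    case True
    then have "A $ j $ i = 0" for i j
      by (metis (mono_tags, lifting) Collect_empty_eq column_def matrix_vector_mult_basis vec_lambda_beta zero_index)
    then have "A = 0" by (simp add: vec_eq_iff)
    then show ?thesis by (simp add: trace_def)
  next
    case False
    then obtain k where k: "A *v axis k 1 \<noteq> 0" by auto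
    define e where "e = (axis k 1 :: real^'n)"
    define y where "y = A *v e"
    define s where "s = e \<bullet> y"
    define B where "B = A - (1/s) *\<^sub>R (\<chi> i j. y $ i * y $ j)"
    have sym: "x \<bullet> (A *v z) = z \<bullet> (A *v x)" for x z
      using A symmetric_form unfolding nonneg_definite_symmetric_def by metis
    have cs: "(x \<bullet> y)\<^sup>2 \<le> (x \<bullet> (A *v x)) * s" for x
      unfolding y_def s_def by (rule semidefinite_Cauchy_Schwarz[OF A])
    have "0 \<le> s"
      using A unfolding s_def y_def nonneg_definite_symmetric_def by blast
    have "y \<noteq> 0" using k by (simp add: y_def e_def)
    then have "s \<noteq> 0" using cs[of y] by auto
    with \<open>0 \<le> s\<close> have s: "0 < s" by simp
    have Bv: "B *v x = A *v x - ((y \<bullet> x) / s) *\<^sub>R y" for x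
      by (simp add: B_def matrix_vector_mult_diff_rdistrib scaleR_matrix_vector_assoc[symmetric] rank_one_mult_vector)
    have "transpose B = B"
      using A by (simp add: B_def nonneg_definite_symmetric_def transpose_def vec_eq_iff algebra_simps)
    moreover have "0 \<le> x \<bullet> (B *v x)" for x
      using cs[of x] s by (simp add: Bv inner_diff_right field_simps power2_eq_square inner_commute)
    ultimately have B: "nonneg_definite_symmetric B"
      by (simp add: nonneg_definite_symmetric_def)
    have kernel: "B *v axis i 1 = 0" if "A *v axis i 1 = 0" for i
    proof -
      have "y \<bullet> axis i 1 = 0"
        using sym[of "axis i 1" e] that by (simp add: y_def inner_commute)
      with that show ?thesis by (simp add: Bv)
    qed
    have "B *v axis k 1 = 0"
      using s by (simp add: Bv flip: e_def) (simp add: y_def[symmetric] s_def inner_commute)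
    then have "{i. B *v axis i 1 \<noteq> 0} \<subset> {i. A *v axis i 1 \<noteq> 0}"
      using kernel k by auto
    then have "card {i. B *v axis i 1 \<noteq> 0} < card {i. A *v axis i 1 \<noteq> 0}"
      by (simp add: psubset_card_mono)
    then have "0 \<le> trace (B ** H)" using less.hyps B by blast
    moreover have "A = B + (1/s) *\<^sub>R (\<chi> i j. y $ i * y $ j)" by (simp add: B_def)
    then have "trace (A ** H) = trace (B ** H) + (1/s) * (y \<bullet> (H *v y))"
      by (metis trace_mult_linear_left trace_mult_rank_one)
    ultimately show ?thesis using H[of y] s by simp
  qed
qed

text \<open>A minimiser \<open>e\<close> of the quadratic form on the unit sphere is an eigenvector for the minimum \<open>m\<close>:
  the semidefinite matrix \<open>A - m I\<close> has \<open>e\<close> as a null vector of its form, and Cauchy-Schwarz makes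
  it a null vector of the matrix. No eigenvalue lies below \<open>m\<close>.\<close>
lemma smallest_eigenvalue_le_Rayleigh:
  fixes A :: "real^'n^'n"
  assumes A: "transpose A = A"
  shows "smallest_eigenvalue A * (v \<bullet> v) \<le> v \<bullet> (A *v v)"
proof -
  have "compact (sphere (0::real^'n) 1)" "sphere (0::real^'n) 1 \<noteq> {}" by auto
  moreover have "continuous_on (sphere 0 1) (\<lambda>v. v \<bullet> (A *v v))"
    by (intro continuous_intros matrix_vector_mult_linear_continuous_on)
  ultimately obtain e where e: "e \<in> sphere 0 1"
    and min: "\<And>v. v \<in> sphere 0 1 \<Longrightarrow> e \<bullet> (A *v e) \<le> v \<bullet> (A *v v)"
    using continuous_attains_inf[of "sphere 0 1" "\<lambda>v. v \<bullet> (A *v v)"] by metis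
  define m where "m = e \<bullet> (A *v e)"
  have Rayleigh: "m * (v \<bullet> v) \<le> v \<bullet> (A *v v)" for v
  proof (cases "v = 0")
    case False
    have "m \<le> (v /\<^sub>R norm v) \<bullet> (A *v (v /\<^sub>R norm v))"
      unfolding m_def using False by (intro min) simp
    also have "\<dots> = (v \<bullet> (A *v v)) / (v \<bullet> v)"
      by (simp add: matrix_vector_mult_scaleR divide_simps flip: power2_norm_eq_inner)
        (simp add: power2_eq_square)
    finally show ?thesis using False by (simp add: field_simps)
  qed simp
  define B where "B = A - m *\<^sub>R mat 1"
  have Bv: "B *v v = A *v v - m *\<^sub>R v" for v
    by (simp add: B_def matrix_vector_mult_diff_rdistrib scaleR_matrix_vector_assoc[symmetric])
  have "transpose B = B"
    using A by (simp add: B_def transpose_def vec_eq_iff mat_def)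
  then have B: "nonneg_definite_symmetric B"
    using Rayleigh by (simp add: nonneg_definite_symmetric_def Bv inner_diff_right)
  have "e \<bullet> (B *v e) = 0"
    using e by (simp add: Bv inner_diff_right m_def norm_eq_1)
  then have "((B *v e) \<bullet> (B *v e))\<^sup>2 \<le> 0"
    using semidefinite_Cauchy_Schwarz[OF B, of "B *v e" e] by simp
  then have "A *v e = m *\<^sub>R e" by (simp add: Bv)
  moreover have "e \<noteq> 0" using e by auto
  moreover have "m \<le> l" if "w \<noteq> 0" "A *v w = l *\<^sub>R w" for l w
    using Rayleigh[of w] that by simp
  ultimately have "smallest_eigenvalue A = m"
    unfolding smallest_eigenvalue_def by (intro Least_equality) auto
  then show ?thesis using Rayleigh by simp
qed

lemma abs_trace_le:
  fixes A :: "real^'n^'n"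
  shows "\<bar>trace A\<bar> \<le> real CARD('n) * norm A"
proof -
  have "\<bar>A $ i $ i\<bar> \<le> norm A" for i
    using Finite_Cartesian_Product.norm_nth_le[of "A $ i" i] Finite_Cartesian_Product.norm_nth_le[of A i] by simp
  then have "\<bar>trace A\<bar> \<le> (\<Sum>i\<in>(UNIV::'n set). norm A)"
    unfolding trace_def by (intro order_trans[OF sum_abs] sum_mono)
  then show ?thesis by simp
qed

section \<open>Second-order conditions at a maximum\<close>

lemma grad_has_derivative:
  fixes u :: "real^'n \<Rightarrow> real"
  assumes "u differentiable (at x)"
  shows "(u has_derivative (\<lambda>h. grad u x \<bullet> h)) (at x)"
proof -
  define D where "D = frechet_derivative u (at x)"
  have D: "(u has_derivative D) (at x)"
    using assms frechet_derivative_works unfolding D_def by blast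
  then interpret linear D by (rule has_derivative_linear)
  have "D h = grad u x \<bullet> h" for h
  proof -
    have "D h = D (\<Sum>i\<in>UNIV. (h $ i) *\<^sub>R axis i 1)"
      by (metis basis_expansion scalar_mult_eq_scaleR)
    also have "\<dots> = (\<Sum>i\<in>UNIV. (h $ i) * D (axis i 1))"
      by (simp add: sum scale)
    finally show ?thesis
      by (simp add: grad_def inner_vec_def D_def mult.commute)
  qed
  then have "D = (\<lambda>h. grad u x \<bullet> h)" by auto
  then show ?thesis using D by simp
qed

text \<open>Both conditions are the one-variable ones along the lines through \<open>p\<close>. If \<open>v \<bullet> H v\<close> were
  positive, the derivative along \<open>v\<close>, which vanishes at \<open>p\<close>, would be positive just after \<open>p\<close>, so
  that \<open>f\<close> would increase there.\<close>
lemma second_order_conditions_at_maximum: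
  fixes f :: "real^'n \<Rightarrow> real" and G :: "real^'n \<Rightarrow> real^'n"
  assumes max: "\<forall>\<^sub>F x in nhds p. f x \<le> f p"
    and f: "\<forall>\<^sub>F x in nhds p. (f has_derivative (\<lambda>h. G x \<bullet> h)) (at x)"
    and G: "(G has_derivative (\<lambda>h. H *v h)) (at p)"
  shows "G p = 0" and "v \<bullet> (H *v v) \<le> 0"
proof -
  have "\<forall>\<^sub>F x in nhds p. f x \<le> f p \<and> (f has_derivative (\<lambda>h. G x \<bullet> h)) (at x)"
    using max f by eventually_elim auto
  then obtain r where "r > 0"
    and r: "\<And>x. dist x p < r \<Longrightarrow> f x \<le> f p"
      "\<And>x. dist x p < r \<Longrightarrow> (f has_derivative (\<lambda>h. G x \<bullet> h)) (at x)"
    unfolding eventually_nhds_metric by blast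
  have first: "G p \<bullet> v = 0" and second: "v \<bullet> (H *v v) \<le> 0" for v
  proof -
    define \<delta> where "\<delta> = r / (norm v + 1)"
    have "\<delta> > 0" using \<open>r > 0\<close> by (simp add: \<delta>_def add_nonneg_pos)
    have near: "dist (p + t *\<^sub>R v) p < r" if "\<bar>t\<bar> < \<delta>" for t
    proof -
      have "\<bar>t\<bar> * norm v \<le> \<bar>t\<bar> * (norm v + 1)" by (simp add: mult_left_mono)
      also have "\<dots> < r" using that by (simp add: \<delta>_def add_nonneg_pos pos_less_divide_eq)
      finally show ?thesis by (simp add: dist_norm)
    qed
    have line: "((\<lambda>t. f (p + t *\<^sub>R v)) has_real_derivative G (p + t *\<^sub>R v) \<bullet> v) (at t)"
      if "\<bar>t\<bar> < \<delta>" for t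
    proof -
      have "((\<lambda>t. p + t *\<^sub>R v) has_derivative (\<lambda>s. s *\<^sub>R v)) (at t)"
        by (auto intro!: derivative_eq_intros)
      from has_derivative_compose[OF this r(2)[OF near[OF that]]]
      show ?thesis by (simp add: has_field_derivative_def mult.commute[of _ "G (p + t *\<^sub>R v) \<bullet> v"])
    qed
    show first: "G p \<bullet> v = 0"
      using DERIV_local_max[OF line[of 0] \<open>\<delta> > 0\<close>] r(1) near \<open>\<delta> > 0\<close> by simp
    show "v \<bullet> (H *v v) \<le> 0"
    proof (rule ccontr)
      assume "\<not> v \<bullet> (H *v v) \<le> 0"
      have "((\<lambda>t. p + t *\<^sub>R v) has_derivative (\<lambda>s. s *\<^sub>R v)) (at 0)"
        by (auto intro!: derivative_eq_intros)
      from has_derivative_compose[OF this, of G "\<lambda>h. H *v h"] G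
      have "((\<lambda>t. G (p + t *\<^sub>R v)) has_derivative (\<lambda>s. H *v (s *\<^sub>R v))) (at 0)"
        by simp
      from has_derivative_inner_left[OF this, of v]
      have "((\<lambda>t. G (p + t *\<^sub>R v) \<bullet> v) has_real_derivative v \<bullet> (H *v v)) (at 0)"
        by (simp add: has_field_derivative_def mult.commute matrix_vector_mult_scaleR inner_commute mult_commute_abs)
      from DERIV_pos_inc_right[OF this] \<open>\<not> v \<bullet> (H *v v) \<le> 0\<close>
      obtain d where "d > 0"
        and d: "\<And>h. 0 < h \<Longrightarrow> h < d \<Longrightarrow> 0 < G (p + h *\<^sub>R v) \<bullet> v"
        using first by auto
      define t where "t = min d \<delta> / 2"
      have t: "0 < t" "t < d" "t < \<delta>" using \<open>d > 0\<close> \<open>\<delta> > 0\<close> by (auto simp: t_def)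
      obtain s where s: "0 < s" "s < t"
        "f (p + t *\<^sub>R v) - f (p + 0 *\<^sub>R v) = (t - 0) * (G (p + s *\<^sub>R v) \<bullet> v)"
        using MVT2[of 0 t "\<lambda>t. f (p + t *\<^sub>R v)" "\<lambda>t. G (p + t *\<^sub>R v) \<bullet> v"] t line by auto
      have "0 < t * (G (p + s *\<^sub>R v) \<bullet> v)" using t s d[of s] by simp
      moreover have "f (p + t *\<^sub>R v) \<le> f p" using r(1) near[of t] t by simp
      ultimately show False using s(3) by simp
    qed
  qed
  show "G p = 0" using first[of "G p"] by simp
  show "v \<bullet> (H *v v) \<le> 0" by (rule second)
qed

text \<open>At a local maximum of \<open>u + \<epsilon> w\<close> the first and second derivatives of \<open>u\<close> are those of \<open>- \<epsilon> w\<close>,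
  up to a semidefinite term of the right sign. The differential inequality for \<open>u\<close> then forces the
  opposite of the strict inequality for \<open>w\<close>. The condition \<open>M \<le> u p + \<epsilon> w p\<close> turns the zeroth
  order term of \<open>u - M\<close> into the one of \<open>- \<epsilon> w\<close>.\<close>
lemma no_maximum_of_strict_perturbation:
  fixes u w :: "real^'n \<Rightarrow> real" and A W :: "real^'n^'n"
  assumes "open S" "p \<in> S" and u: "C2_on S u"
    and A: "nonneg_definite_symmetric A" and "0 \<le> \<gamma>" and "0 < \<epsilon>"
    and sub: "\<gamma> * (u p - M) \<le> trace (A ** hessian u p) + \<beta> \<bullet> grad u p"
    and w: "\<And>x. (w has_derivative (\<lambda>h. G x \<bullet> h)) (at x)"
    and G: "(G has_derivative (\<lambda>h. W *v h)) (at p)"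
    and strict: "0 < trace (A ** W) + \<beta> \<bullet> G p - \<gamma> * w p"
    and max: "\<forall>\<^sub>F x in nhds p. u x + \<epsilon> * w x \<le> u p + \<epsilon> * w p"
    and M: "M \<le> u p + \<epsilon> * w p"
  shows False
proof -
  have "\<forall>\<^sub>F x in nhds p. x \<in> S" using assms(1,2) by (rule eventually_nhds_in_open)
  then have d1: "\<forall>\<^sub>F x in nhds p.
      ((\<lambda>x. u x + \<epsilon> * w x) has_derivative (\<lambda>h. (grad u x + \<epsilon> *\<^sub>R G x) \<bullet> h)) (at x)"
  proof eventually_elim
    case (elim x)
    then have "(u has_derivative (\<lambda>h. grad u x \<bullet> h)) (at x)"
      using u unfolding C2_on_def by (auto intro: grad_has_derivative)
    from has_derivative_add[OF this has_derivative_mult_right[OF w, of \<epsilon>]]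
    show ?case by (simp add: inner_add_left)
  qed
  have "(grad u has_derivative (\<lambda>h. hessian u p *v h)) (at p)"
    using u \<open>p \<in> S\<close> unfolding C2_on_def hessian_def jacobian_works by blast
  from has_derivative_add[OF this has_derivative_scaleR_right[OF G, of \<epsilon>]]
  have d2: "((\<lambda>x. grad u x + \<epsilon> *\<^sub>R G x) has_derivative (\<lambda>h. (hessian u p + \<epsilon> *\<^sub>R W) *v h)) (at p)"
    by (simp add: matrix_vector_mult_add_rdistrib scaleR_matrix_vector_assoc)
  have Du: "grad u p + \<epsilon> *\<^sub>R G p = 0"
    and neg: "\<And>v. v \<bullet> ((hessian u p + \<epsilon> *\<^sub>R W) *v v) \<le> 0"
    using second_order_conditions_at_maximum[OF max d1 d2] by auto
  have "0 \<le> trace (A ** (0 + (-1) *\<^sub>R (hessian u p + \<epsilon> *\<^sub>R W)))"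
  proof (rule trace_mult_semidefinite_nonneg[OF A])
    fix v
    have "(0 + (-1) *\<^sub>R (hessian u p + \<epsilon> *\<^sub>R W)) *v v = - ((hessian u p + \<epsilon> *\<^sub>R W) *v v)"
      by (simp only: add_0 scaleR_matrix_vector_assoc[symmetric]) simp
    then show "0 \<le> v \<bullet> ((0 + (-1) *\<^sub>R (hessian u p + \<epsilon> *\<^sub>R W)) *v v)"
      using neg[of v] by simp
  qed
  also have "\<dots> = - (trace (A ** hessian u p) + \<epsilon> * trace (A ** W))"
    unfolding trace_mul_sym[of A] trace_mult_linear_left by (simp add: trace_def)
  finally have "trace (A ** hessian u p) + \<epsilon> * trace (A ** W) \<le> 0" by simp
  moreover have "\<beta> \<bullet> grad u p + \<epsilon> * (\<beta> \<bullet> G p) = 0"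
    using Du by (metis inner_add_right inner_scaleR_right inner_zero_right)
  moreover have "\<gamma> * (M - u p) \<le> \<gamma> * (\<epsilon> * w p)"
    using M \<open>0 \<le> \<gamma>\<close> by (intro mult_left_mono) auto
  moreover have "0 < \<epsilon> * (trace (A ** W) + \<beta> \<bullet> G p - \<gamma> * w p)"
    using strict \<open>0 < \<epsilon>\<close> by simp
  ultimately show False using sub by (simp add: algebra_simps)
qed

section \<open>Perturbation by quadratic barriers\<close>

text \<open>The maximisers \<open>p\<close> of \<open>u + \<epsilon> w\<close> satisfy \<open>M \<le> u p + \<epsilon> w p\<close>, whence \<open>0 \<le> w p\<close> because of
  \<open>u p \<le> M\<close>. Letting \<open>\<epsilon>\<close> tend to 0, they accumulate at a point \<open>q\<close> of the contact set where
  \<open>u = M\<close> and \<open>0 \<le> w\<close>. Hence \<open>w\<close> need be a strict subsolution only near the contact set. This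
  is what replaces the comparison on an annulus in Hopf's argument, and at the degenerate boundary
  it spares any rate for the decay of \<open>a\<close>.\<close>
lemma perturbed_maximum_near_contact:
  fixes u w :: "'a::metric_space \<Rightarrow> real"
  assumes Q: "compact Q" and u: "continuous_on Q u" and w: "continuous_on Q w"
    and M: "\<And>x. x \<in> Q \<Longrightarrow> u x \<le> M" and z: "z \<in> Q" "u z = M" "w z = 0"
  obtains q where "q \<in> Q" "u q = M" "0 \<le> w q"
    and "\<And>N. open N \<Longrightarrow> q \<in> N \<Longrightarrow>
      \<exists>\<epsilon>>0. \<exists>p\<in>Q \<inter> N. \<forall>x\<in>Q. u x + \<epsilon> * w x \<le> u p + \<epsilon> * w p"
proof -
  define \<epsilon> where "\<epsilon> k = inverse (real (Suc k))" for k
  have \<epsilon>: "0 < \<epsilon> k" for k by (simp add: \<epsilon>_def)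
  have "\<exists>p\<in>Q. \<forall>x\<in>Q. u x + \<epsilon> k * w x \<le> u p + \<epsilon> k * w p" for k
    using z(1) by (intro continuous_attains_sup Q continuous_intros u w) auto
  then obtain P where P: "\<And>k. P k \<in> Q"
    and max: "\<And>k x. x \<in> Q \<Longrightarrow> u x + \<epsilon> k * w x \<le> u (P k) + \<epsilon> k * w (P k)"
    by metis
  have above: "M \<le> u (P k) + \<epsilon> k * w (P k)" for k
    using max[OF z(1), of k] z by simp
  have wP: "0 \<le> w (P k)" for k
  proof -
    have "0 \<le> \<epsilon> k * w (P k)" using above[of k] M[OF P[of k]] by linarith
    then show ?thesis using \<epsilon>[of k] by (simp add: zero_le_mult_iff)
  qed
  obtain q \<sigma> where q: "q \<in> Q" "strict_mono \<sigma>" and lim: "(P \<circ> \<sigma>) \<longlonglongrightarrow> q"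
    using Q P unfolding compact_def by metis
  have "(\<lambda>k. u (P (\<sigma> k))) \<longlonglongrightarrow> u q" "(\<lambda>k. w (P (\<sigma> k))) \<longlonglongrightarrow> w q"
    using continuous_on_tendsto_compose[OF u lim q(1)] continuous_on_tendsto_compose[OF w lim q(1)] P
    by (auto simp: o_def)
  note ulim = this(1) and wlim = this(2)
  have "(\<lambda>k. \<epsilon> (\<sigma> k)) \<longlonglongrightarrow> 0"
    using LIMSEQ_subseq_LIMSEQ[OF LIMSEQ_inverse_real_of_nat q(2)] by (simp add: \<epsilon>_def o_def)
  from tendsto_add[OF ulim tendsto_mult[OF this wlim]]
  have "(\<lambda>k. u (P (\<sigma> k)) + \<epsilon> (\<sigma> k) * w (P (\<sigma> k))) \<longlonglongrightarrow> u q" by simp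
  then have "M \<le> u q"
    using above by (intro LIMSEQ_le_const) auto
  then have "u q = M" using M q(1) by (simp add: order_antisym)
  moreover have "0 \<le> w q" using wP by (intro LIMSEQ_le_const[OF wlim]) auto
  moreover have "\<exists>\<epsilon>>0. \<exists>p\<in>Q \<inter> N. \<forall>x\<in>Q. u x + \<epsilon> * w x \<le> u p + \<epsilon> * w p"
    if "open N" "q \<in> N" for N
  proof -
    have "\<forall>\<^sub>F k in sequentially. P (\<sigma> k) \<in> N"
      using topological_tendstoD[OF lim that] by (simp add: o_def)
    then obtain k where "P (\<sigma> k) \<in> N"
      using eventually_happens by force
    then show ?thesis using \<epsilon>[of "\<sigma> k"] P max by blast
  qed
  ultimately show ?thesis by (intro that[OF q(1)])
qed

text \<open>The quadratic barrier vanishes at \<open>z\<close> with gradient \<open>n\<close>. The term with \<open>L\<close> pushes the set where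
  it is nonnegative to the side of \<open>z\<close> into which \<open>n\<close> points; the term with \<open>K\<close> adds as much second
  derivative in the direction \<open>n\<close> as ellipticity can use, without changing the value and the
  gradient at \<open>z\<close>.\<close>
definition barrier :: "real^'n \<Rightarrow> real \<Rightarrow> real \<Rightarrow> real^'n \<Rightarrow> real^'n \<Rightarrow> real" where
  "barrier n K L z x = n \<bullet> (x - z) + K * (n \<bullet> (x - z))\<^sup>2 - L * ((x - z) \<bullet> (x - z))"

definition barrier_grad :: "real^'n \<Rightarrow> real \<Rightarrow> real \<Rightarrow> real^'n \<Rightarrow> real^'n \<Rightarrow> real^'n" where
  "barrier_grad n K L z x = n + (2 * K * (n \<bullet> (x - z))) *\<^sub>R n - (2 * L) *\<^sub>R (x - z)"

definition barrier_hessian :: "real^'n \<Rightarrow> real \<Rightarrow> real \<Rightarrow> real^'n^'n" where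
  "barrier_hessian n K L = (2 * K) *\<^sub>R (\<chi> i j. n $ i * n $ j) + (- 2 * L) *\<^sub>R mat 1"

lemma barrier_has_derivative:
  "(barrier n K L z has_derivative (\<lambda>h. barrier_grad n K L z x \<bullet> h)) (at x)"
proof -
  have *: "((\<lambda>x. x - z) has_derivative (\<lambda>h. h)) (at x)"
    by (auto intro!: derivative_eq_intros)
  have n: "((\<lambda>x. n \<bullet> (x - z)) has_derivative (\<lambda>h. n \<bullet> h)) (at x)"
    by (rule has_derivative_inner_right[OF *])
  have "(barrier n K L z has_derivative (\<lambda>h. n \<bullet> h
      + K * ((n \<bullet> (x - z)) * (n \<bullet> h) + (n \<bullet> h) * (n \<bullet> (x - z)))
      - L * ((x - z) \<bullet> h + h \<bullet> (x - z)))) (at x)"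
    unfolding barrier_def[abs_def] power2_eq_square
    by (intro has_derivative_diff has_derivative_add has_derivative_mult_right
        has_derivative_mult[OF n n] has_derivative_inner[OF * *] n)
  also have "(\<lambda>h. n \<bullet> h + K * ((n \<bullet> (x - z)) * (n \<bullet> h) + (n \<bullet> h) * (n \<bullet> (x - z)))
      - L * ((x - z) \<bullet> h + h \<bullet> (x - z))) = (\<lambda>h. barrier_grad n K L z x \<bullet> h)"
    by (simp add: barrier_grad_def inner_add_left inner_diff_left inner_commute algebra_simps)
  finally show ?thesis .
qed

lemma barrier_grad_has_derivative:
  "(barrier_grad n K L z has_derivative (\<lambda>h. barrier_hessian n K L *v h)) (at x)"
proof -
  have "barrier_hessian n K L *v h = (2 * K * (n \<bullet> h)) *\<^sub>R n - (2 * L) *\<^sub>R h" for h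
    unfolding barrier_hessian_def matrix_vector_mult_add_rdistrib
      scaleR_matrix_vector_assoc[symmetric] rank_one_mult_vector by simp
  then show ?thesis
    unfolding barrier_grad_def[abs_def] by (auto intro!: derivative_eq_intros)
qed

lemma trace_mult_barrier_hessian:
  fixes A :: "real^'n^'n"
  shows "trace (A ** barrier_hessian n K L) = 2 * K * (n \<bullet> (A *v n)) - 2 * L * trace A"
proof -
  have zero: "trace (0 :: real^'n^'n) = 0" by (simp add: trace_def)
  have "trace (A ** barrier_hessian n K L) = trace ((0 + 1 *\<^sub>R barrier_hessian n K L) ** A)"
    by (simp add: trace_mul_sym[of A])
  also have "\<dots> = 2 * K * (n \<bullet> (A *v n)) - 2 * L * trace A"
    unfolding barrier_hessian_def
    using trace_mult_linear_left[of "(2 * K) *\<^sub>R (\<chi> i j. n $ i * n $ j)" "- 2 * L" "mat 1" A]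
      trace_mult_linear_left[of 0 "2 * K" "\<chi> i j. n $ i * n $ j" A]
    unfolding trace_mult_rank_one by (simp add: zero)
  finally show ?thesis .
qed

lemma continuous_on_barrier: "continuous_on X (barrier n K L z)"
  by (rule has_derivative_continuous_on[OF has_derivative_at_withinI[OF barrier_has_derivative]])

lemma continuous_on_barrier_grad: "continuous_on X (barrier_grad n K L z)"
  by (rule has_derivative_continuous_on[OF has_derivative_at_withinI[OF barrier_grad_has_derivative]])

section \<open>The inward normal of a differentiable boundary portion\<close>

text \<open>Here \<open>f\<close> is a defining function of \<open>S\<close> near its boundary point \<open>p\<close>.\<close>
lemma eventually_inward_side:
  fixes f :: "real^'n \<Rightarrow> real"
  assumes f: "(f has_derivative (\<lambda>h. \<nu> \<bullet> h)) (at p)" and "f p = 0"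
    and side: "\<forall>\<^sub>F x in nhds p. x \<in> S \<longleftrightarrow> 0 < f x"
  shows "0 < \<nu> \<bullet> h \<Longrightarrow> \<forall>\<^sub>F t in at_right 0. p + t *\<^sub>R h \<in> S"
    and "\<nu> \<bullet> h < 0 \<Longrightarrow> \<forall>\<^sub>F t in at_right 0. p + t *\<^sub>R h \<notin> S"
proof -
  have "((\<lambda>t. p + t *\<^sub>R h) has_derivative (\<lambda>s. s *\<^sub>R h)) (at 0)"
    by (auto intro!: derivative_eq_intros)
  from has_derivative_compose[OF this, of f "\<lambda>h. \<nu> \<bullet> h"] f
  have "((\<lambda>t. f (p + t *\<^sub>R h)) has_derivative (\<lambda>t. t * (\<nu> \<bullet> h))) (at 0)" by simp
  then have der: "((\<lambda>t. f (p + t *\<^sub>R h)) has_real_derivative \<nu> \<bullet> h) (at 0)"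
    by (simp add: has_field_derivative_def mult.commute[of _ "\<nu> \<bullet> h"])
  have "((\<lambda>t. p + t *\<^sub>R h) \<longlongrightarrow> p + 0 *\<^sub>R h) (at_right 0)"
    by (intro tendsto_intros)
  then have "((\<lambda>t. p + t *\<^sub>R h) \<longlongrightarrow> p) (at_right 0)" by simp
  then have ev: "\<forall>\<^sub>F t in at_right 0. p + t *\<^sub>R h \<in> S \<longleftrightarrow> 0 < f (p + t *\<^sub>R h)"
    using side by (rule eventually_compose_filterlim[rotated])
  show "\<forall>\<^sub>F t in at_right 0. p + t *\<^sub>R h \<in> S" if pos: "0 < \<nu> \<bullet> h"
  proof -
    obtain d where "d > 0" and d: "\<And>t. 0 < t \<Longrightarrow> t < d \<Longrightarrow> 0 < f (p + t *\<^sub>R h)"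
      using DERIV_pos_inc_right[OF der pos] \<open>f p = 0\<close> by auto
    then have "\<forall>\<^sub>F t in at_right 0. 0 < f (p + t *\<^sub>R h)"
      unfolding eventually_at_right_field by (intro exI[of _ d]) auto
    with ev show ?thesis by eventually_elim auto
  qed
  show "\<forall>\<^sub>F t in at_right 0. p + t *\<^sub>R h \<notin> S" if neg: "\<nu> \<bullet> h < 0"
  proof -
    obtain d where "d > 0" and d: "\<And>t. 0 < t \<Longrightarrow> t < d \<Longrightarrow> f (p + t *\<^sub>R h) < 0"
      using DERIV_neg_dec_right[OF der neg] \<open>f p = 0\<close> by auto
    then have "\<forall>\<^sub>F t in at_right 0. f (p + t *\<^sub>R h) < 0"
      unfolding eventually_at_right_field by (intro exI[of _ d]) auto
    with ev show ?thesis by eventually_elim auto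
  qed
qed

text \<open>The description of \<open>inward_unit_normal\<close> determines a vector only if every vector orthogonal to
  \<open>\<nu>\<close> is a tangent vector; then a competitor is plus or minus the normalised \<open>\<nu>\<close>, and the minus sign
  points out of \<open>S\<close>.\<close>
lemma inward_unit_normal_eq:
  fixes \<nu> :: "real^'n"
  assumes "\<nu> \<noteq> 0" and tangent: "\<And>v. v \<in> tangent_vectors S p \<longleftrightarrow> \<nu> \<bullet> v = 0"
    and inside: "\<And>h. 0 < \<nu> \<bullet> h \<Longrightarrow> \<forall>\<^sub>F t in at_right 0. p + t *\<^sub>R h \<in> S"
    and outside: "\<And>h. \<nu> \<bullet> h < 0 \<Longrightarrow> \<forall>\<^sub>F t in at_right 0. p + t *\<^sub>R h \<notin> S"
  shows "inward_unit_normal S p = \<nu> /\<^sub>R norm \<nu>"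
proof -
  define n where "n = \<nu> /\<^sub>R norm \<nu>"
  have "norm n = 1" using \<open>\<nu> \<noteq> 0\<close> by (simp add: n_def)
  then have n: "norm n = 1" "n \<bullet> n = 1" by (simp_all add: norm_eq_1)
  have pos: "0 < norm \<nu>" using \<open>\<nu> \<noteq> 0\<close> by simp
  have \<nu>n: "\<nu> \<bullet> v = norm \<nu> * (n \<bullet> v)" for v using pos by (simp add: n_def)
  show ?thesis
    unfolding inward_unit_normal_def n_def[symmetric]
  proof (rule the_equality, intro conjI ballI)
    show "norm n = 1" by (rule n)
    show "v \<bullet> n = 0" if "v \<in> tangent_vectors S p" for v
      using that pos by (simp add: tangent \<nu>n inner_commute)
    show "\<forall>\<^sub>F t in at_right 0. p + t *\<^sub>R n \<in> S"
      using pos n by (intro inside) (simp add: \<nu>n)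
  next
    fix m assume m: "norm m = 1 \<and> (\<forall>v\<in>tangent_vectors S p. v \<bullet> m = 0) \<and>
             (\<forall>\<^sub>F t in at_right (0::real). p + t *\<^sub>R m \<in> S)"
    define c where "c = m \<bullet> n"
    define v where "v = m - c *\<^sub>R n"
    have "n \<bullet> v = 0" using n by (simp add: v_def c_def inner_diff_right inner_commute)
    then have "v \<bullet> m = 0" using m tangent[of v] by (simp add: \<nu>n)
    then have "v \<bullet> v = 0"
      using \<open>n \<bullet> v = 0\<close> by (simp add: v_def inner_diff_right inner_commute)
    then have mc: "m = c *\<^sub>R n" by (simp add: v_def)
    then have "\<bar>c\<bar> = 1" using m n by simp
    moreover have "c \<noteq> - 1"
    proof
      assume "c = - 1"
      then have "\<forall>\<^sub>F t in at_right 0. p + t *\<^sub>R m \<notin> S"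
        using pos n mc by (intro outside) (simp add: \<nu>n)
      moreover have "\<forall>\<^sub>F t in at_right 0. p + t *\<^sub>R m \<in> S" using m by simp
      ultimately have "\<forall>\<^sub>F t in at_right (0::real). False" by eventually_elim simp
      then show False by simp
    qed
    ultimately have "c = 1" by (auto simp: abs_if split: if_splits)
    then show "m = n" using mc by simp
  qed
qed

text \<open>Let \<open>\<psi>\<close> flatten the boundary near \<open>p\<close>. The definition of a boundary portion only says that \<open>\<psi>\<close>
  maps points of \<open>S\<close> above the hyperplane and frontier points into it. Connectedness gives the
  converse: a small upper half ball in the image meets the image of \<open>S\<close> and misses that of the
  frontier, so it comes from \<open>S\<close> entirely. Hence near \<open>p\<close> the coordinate \<open>\<phi>\<close> of \<open>\<psi>\<close> that vanishes
  on the hyperplane is positive exactly on \<open>S\<close>, and the hyperplane comes from the frontier. So the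
  gradient \<open>\<nu>\<close> of \<open>\<phi>\<close> at \<open>p\<close>, which is not 0 as \<open>\<psi>\<close> has a differentiable inverse, is a positive
  multiple of the inward unit normal. Two consequences are used: the frontier deviates from its
  tangent plane by \<open>o(dist x p)\<close>, and vectors on the inner side of that plane point into \<open>S\<close>.\<close>
lemma C1_Hoelder_boundary_portion_normal:
  fixes S T :: "(real^'n) set"
  assumes "open S" and T: "C1_Hoelder_boundary_portion \<alpha> S T" and "p \<in> T"
  shows "norm (inward_unit_normal S p) = 1"
    and "0 < e \<Longrightarrow> \<exists>\<delta>>0. \<forall>x\<in>frontier S. dist x p < \<delta> \<longrightarrow>
           \<bar>inward_unit_normal S p \<bullet> (x - p)\<bar> \<le> e * dist x p"
    and "0 < inward_unit_normal S p \<bullet> h \<Longrightarrow> \<forall>\<^sub>F t in at_right 0. p + t *\<^sub>R h \<in> S"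
proof -
  note charts = bspec[OF conjunct2[OF T[unfolded C1_Hoelder_boundary_portion_def]] \<open>p \<in> T\<close>]
  obtain r and \<psi> :: "real^'n \<Rightarrow> real^'n" and k where "r > 0" and chart: "let B = ball p r in
          inj_on \<psi> B \<and> open (\<psi> ` B) \<and>
          \<psi> ` (B \<inter> S) \<subseteq> {y. y $ k > 0} \<and>
          \<psi> ` (B \<inter> frontier S) \<subseteq> {y. y $ k = 0} \<and>
          C1_Hoelder_on \<alpha> B \<psi> \<and>
          C1_Hoelder_on \<alpha> (\<psi> ` B) (the_inv_into B \<psi>) \<and>
          B \<inter> frontier S \<subseteq> T"
    using charts by (elim exE conjE) (rule that)
  define B where "B = ball p r"
  define \<eta> where "\<eta> = the_inv_into B \<psi>"
  have inj: "inj_on \<psi> B" and op: "open (\<psi> ` B)"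
    and inS: "\<And>x. x \<in> B \<Longrightarrow> x \<in> S \<Longrightarrow> 0 < \<psi> x $ k"
    and fr: "\<And>x. x \<in> B \<Longrightarrow> x \<in> frontier S \<Longrightarrow> \<psi> x $ k = 0"
    and d\<psi>: "\<And>x. x \<in> B \<Longrightarrow> \<psi> differentiable (at x)"
    and d\<eta>: "\<And>y. y \<in> \<psi> ` B \<Longrightarrow> \<eta> differentiable (at y)"
    using chart unfolding Let_def B_def[symmetric] \<eta>_def C1_Hoelder_on_def
    by auto
  have "open B" "p \<in> B" using \<open>r > 0\<close> by (auto simp: B_def)
  have \<eta>\<psi>: "\<eta> (\<psi> x) = x" if "x \<in> B" for x
    unfolding \<eta>_def by (rule the_inv_into_f_f[OF inj that])
  have \<psi>\<eta>: "\<psi> (\<eta> y) = y" "\<eta> y \<in> B" if "y \<in> \<psi> ` B" for y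
    using that \<eta>\<psi> by auto
  have p: "p \<in> frontier S" using T \<open>p \<in> T\<close> unfolding C1_Hoelder_boundary_portion_def by blast
  have c\<psi>: "isCont \<psi> x" if "x \<in> B" for x using d\<psi>[OF that] by (rule differentiable_imp_continuous_within)
  have c\<eta>: "isCont \<eta> y" if "y \<in> \<psi> ` B" for y using d\<eta>[OF that] by (rule differentiable_imp_continuous_within)
  define y where "y = \<psi> p"
  have y: "y \<in> \<psi> ` B" "y $ k = 0" using \<open>p \<in> B\<close> p fr by (auto simp: y_def)
  obtain s where "s > 0" and s: "ball y s \<subseteq> \<psi> ` B"
    using op y open_contains_ball by blast
  have near: "\<forall>\<^sub>F x in nhds p. x \<in> B \<and> \<psi> x \<in> ball y s"
  proof (rule eventually_conj)
    show "\<forall>\<^sub>F x in nhds p. x \<in> B" using \<open>open B\<close> \<open>p \<in> B\<close> by (rule eventually_nhds_in_open)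
    have "(\<psi> \<longlongrightarrow> y) (nhds p)"
      using c\<psi>[OF \<open>p \<in> B\<close>] unfolding y_def isCont_def tendsto_nhds_iff by blast
    then show "\<forall>\<^sub>F x in nhds p. \<psi> x \<in> ball y s"
      using \<open>s > 0\<close> by (intro topological_tendstoD) auto
  qed
  define P where "P = ball y s \<inter> {z. 0 < z $ k}"
  have "P \<subseteq> \<psi> ` B" using s by (auto simp: P_def)
  have PS: "\<eta> z \<in> S" if "z \<in> P" for z
  proof -
    have "convex {z::real^'n. 0 < z $ k}"
      using convex_halfspace_gt[of 0 "axis k 1 :: real^'n"] by (simp add: inner_axis' )
    then have "connected P" unfolding P_def by (intro convex_connected convex_Int convex_ball)
    then have conn: "connected (\<eta> ` P)"
      using \<open>P \<subseteq> \<psi> ` B\<close> c\<eta> by (intro connected_continuous_image continuous_at_imp_continuous_on) auto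
    obtain d where "d > 0" and d: "\<And>x. dist x p < d \<Longrightarrow> x \<in> B \<and> \<psi> x \<in> ball y s"
      using near unfolding eventually_nhds_metric by blast
    have "p \<in> closure S" using p by (simp add: frontier_def)
    then obtain x where "x \<in> S" "dist x p < d" using \<open>d > 0\<close> by (meson closure_approachable)
    then have "x = \<eta> (\<psi> x)" "\<psi> x \<in> P" using d inS \<eta>\<psi> by (auto simp: P_def)
    then have "\<eta> ` P \<inter> S \<noteq> {}" using \<open>x \<in> S\<close> by (metis disjoint_iff imageI)
    moreover have "\<eta> ` P \<inter> frontier S = {}"
    proof -
      have "\<eta> z \<notin> frontier S" if "z \<in> P" for z
        using fr[of "\<eta> z"] \<psi>\<eta>[of z] \<open>P \<subseteq> \<psi> ` B\<close> that by (auto simp: P_def)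
      then show ?thesis by auto
    qed
    ultimately have "\<eta> ` P - S = {}" using connected_Int_frontier[OF conn] by blast
    then show ?thesis using that by blast
  qed
  \<comment> \<open>points of the hyperplane are limits of points of the upper half ball\<close>
  have flat: "\<eta> z \<in> frontier S" if "z \<in> ball y s" "z $ k = 0" for z
  proof -
    have zB: "z \<in> \<psi> ` B" using s that by auto
    have "\<eta> z \<notin> S" using inS[of "\<eta> z"] \<psi>\<eta>[OF zB] that by auto
    moreover have "\<eta> z \<in> closure S"
    proof (rule Lim_in_closed_set)
      define c where "c t = z + t *\<^sub>R axis k 1" for t :: real
      have "(c \<longlongrightarrow> z + 0 *\<^sub>R axis k 1) (at_right 0)" unfolding c_def by (intro tendsto_intros)
      then have c: "(c \<longlongrightarrow> z) (at_right 0)" by simp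
      have "\<forall>\<^sub>F t in at_right 0. c t \<in> ball y s" using topological_tendstoD[OF c _ that(1)] by simp
      moreover have "\<forall>\<^sub>F t in at_right (0::real). 0 < t" by (simp add: eventually_at_right_less)
      ultimately have "\<forall>\<^sub>F t in at_right 0. c t \<in> P"
        by eventually_elim (auto simp: P_def c_def that(2))
      then show "\<forall>\<^sub>F t in at_right 0. \<eta> (c t) \<in> closure S"
        by eventually_elim (meson PS closure_subset subsetD)
      show "((\<lambda>t. \<eta> (c t)) \<longlongrightarrow> \<eta> z) (at_right 0)"
        by (rule isCont_tendsto_compose[OF c\<eta>[OF zB] c])
    qed auto
    ultimately show ?thesis using \<open>open S\<close> by (simp add: frontier_def interior_open)
  qed
  define \<phi> where "\<phi> x = \<psi> x $ k" for x
  obtain D where D: "(\<psi> has_derivative D) (at p)" using d\<psi>[OF \<open>p \<in> B\<close>] by (auto simp: differentiable_def)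
  obtain E where E: "(\<eta> has_derivative E) (at y)" using d\<eta>[OF y(1)] by (auto simp: differentiable_def)
  have linD: "linear D" and linE: "linear E"
    using D E has_derivative_linear by auto
  have "\<eta> y = p" using \<eta>\<psi> \<open>p \<in> B\<close> by (simp add: y_def)
  have ED: "E (D v) = v" for v
  proof -
    have "((\<lambda>x. \<eta> (\<psi> x)) has_derivative (\<lambda>v. E (D v))) (at p)"
      using has_derivative_compose[OF D, of \<eta> E] E by (simp add: y_def)
    moreover have "((\<lambda>x. \<eta> (\<psi> x)) has_derivative (\<lambda>v. v)) (at p)"
      using has_derivative_ident \<open>open B\<close> \<open>p \<in> B\<close>
      by (rule has_derivative_transform_within_open) (simp add: \<eta>\<psi>)
    ultimately show ?thesis by (metis has_derivative_unique)
  qed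
  have DE: "D (E v) = v" for v
  proof -
    have "((\<lambda>z. \<psi> (\<eta> z)) has_derivative (\<lambda>v. D (E v))) (at y)"
      using has_derivative_compose[OF E, of \<psi> D] D by (simp add: \<open>\<eta> y = p\<close>)
    moreover have "((\<lambda>z. \<psi> (\<eta> z)) has_derivative (\<lambda>v. v)) (at y)"
      using has_derivative_ident op y(1)
      by (rule has_derivative_transform_within_open) (simp add: \<psi>\<eta>)
    ultimately show ?thesis by (metis has_derivative_unique)
  qed
  define \<nu> where "\<nu> = matrix D $ k"
  have D\<nu>: "D v $ k = \<nu> \<bullet> v" for v
    using matrix_vector_mul_component[of "matrix D" v k] matrix_vector_mul(2)[OF linD, THEN fun_cong, of v]
    by (simp add: \<nu>_def)
  have "\<nu> \<noteq> 0" using D\<nu>[of "E (axis k 1)"] by (auto simp: DE)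
  have d\<phi>: "(\<phi> has_derivative (\<lambda>h. \<nu> \<bullet> h)) (at p)"
    using bounded_linear.has_derivative[OF bounded_linear_vec_nth D, of k] by (simp add: \<phi>_def[abs_def] D\<nu>)
  have "\<phi> p = 0" using y by (simp add: \<phi>_def y_def)
  have side: "\<forall>\<^sub>F x in nhds p. x \<in> S \<longleftrightarrow> 0 < \<phi> x"
    using near
  proof eventually_elim
    case (elim x)
    then show ?case using inS[of x] PS[of "\<psi> x"] \<eta>\<psi>[of x] by (auto simp: \<phi>_def P_def)
  qed
  have tangent: "v \<in> tangent_vectors S p \<longleftrightarrow> \<nu> \<bullet> v = 0" for v
  proof
    assume "v \<in> tangent_vectors S p"
    then obtain \<gamma> where "\<gamma> 0 = p" and ev: "\<forall>\<^sub>F t in at (0::real). \<gamma> t \<in> frontier S"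
      and \<gamma>: "(\<gamma> has_vector_derivative v) (at 0)"
      unfolding tangent_vectors_def by blast
    have "((\<lambda>t. \<phi> (\<gamma> t)) has_derivative (\<lambda>t. \<nu> \<bullet> (t *\<^sub>R v))) (at 0)"
      using has_derivative_compose[OF \<gamma>[unfolded has_vector_derivative_def], of \<phi> "\<lambda>h. \<nu> \<bullet> h"] d\<phi> \<open>\<gamma> 0 = p\<close> by simp
    moreover have "((\<lambda>t. \<phi> (\<gamma> t)) has_derivative (\<lambda>t. 0)) (at 0)"
    proof (rule has_derivative_transform_eventually[OF has_derivative_const])
      have "isCont \<gamma> 0" using \<gamma> has_vector_derivative_continuous by blast
      then have "(\<gamma> \<longlongrightarrow> p) (at 0)" using \<open>\<gamma> 0 = p\<close> by (simp add: isCont_def)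
      then have "\<forall>\<^sub>F t in at 0. \<gamma> t \<in> B" using \<open>open B\<close> \<open>p \<in> B\<close> by (rule topological_tendstoD)
      with ev show "\<forall>\<^sub>F t in at 0. 0 = \<phi> (\<gamma> t)"
        by eventually_elim (simp add: \<phi>_def fr)
      show "0 = \<phi> (\<gamma> 0)" using \<open>\<gamma> 0 = p\<close> \<open>\<phi> p = 0\<close> by simp
    qed simp
    ultimately have "(\<lambda>t. \<nu> \<bullet> (t *\<^sub>R v)) = (\<lambda>t. 0)" by (rule has_derivative_unique)
    then show "\<nu> \<bullet> v = 0" by (metis scaleR_one)
  next
    assume "\<nu> \<bullet> v = 0"
    define \<gamma> where "\<gamma> t = \<eta> (y + t *\<^sub>R D v)" for t
    have line: "((\<lambda>t. y + t *\<^sub>R D v) has_derivative (\<lambda>t. t *\<^sub>R D v)) (at 0)"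
      by (auto intro!: derivative_eq_intros)
    have "(\<gamma> has_derivative (\<lambda>t. E (t *\<^sub>R D v))) (at 0)"
      unfolding \<gamma>_def[abs_def] using has_derivative_compose[OF line, of \<eta> E] E by simp
    then have "(\<gamma> has_vector_derivative v) (at 0)"
      by (simp add: has_vector_derivative_def linear_cmul[OF linE] ED)
    moreover have "\<gamma> 0 = p" by (simp add: \<gamma>_def \<open>\<eta> y = p\<close>)
    moreover have "\<forall>\<^sub>F t in at 0. \<gamma> t \<in> frontier S"
    proof -
      have "((\<lambda>t. y + t *\<^sub>R D v) \<longlongrightarrow> y + 0 *\<^sub>R D v) (at 0)" by (intro tendsto_intros)
      then have "\<forall>\<^sub>F t in at 0. y + t *\<^sub>R D v \<in> ball y s"
        using \<open>s > 0\<close> by (intro topological_tendstoD) auto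
      then show ?thesis
        by eventually_elim (auto simp: \<gamma>_def y D\<nu> \<open>\<nu> \<bullet> v = 0\<close> intro!: flat)
    qed
    ultimately show "v \<in> tangent_vectors S p" unfolding tangent_vectors_def by blast
  qed
  note sides = eventually_inward_side[OF d\<phi> \<open>\<phi> p = 0\<close> side]
  have normal: "inward_unit_normal S p = \<nu> /\<^sub>R norm \<nu>"
    by (rule inward_unit_normal_eq[OF \<open>\<nu> \<noteq> 0\<close> tangent sides])
  have pos: "0 < norm \<nu>" using \<open>\<nu> \<noteq> 0\<close> by simp
  show "norm (inward_unit_normal S p) = 1" using \<open>\<nu> \<noteq> 0\<close> by (simp add: normal)
  show "\<forall>\<^sub>F t in at_right 0. p + t *\<^sub>R h \<in> S" if "0 < inward_unit_normal S p \<bullet> h"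
    using that pos by (intro sides) (simp add: normal zero_less_mult_iff)
  show "\<exists>\<delta>>0. \<forall>x\<in>frontier S. dist x p < \<delta> \<longrightarrow>
           \<bar>inward_unit_normal S p \<bullet> (x - p)\<bar> \<le> e * dist x p" if "0 < e"
  proof -
    have "0 < e * norm \<nu>" using that pos by simp
    then    obtain d where "d > 0" and d: "\<And>x. norm (x - p) < d \<Longrightarrow>
        norm (\<phi> x - \<phi> p - \<nu> \<bullet> (x - p)) \<le> (e * norm \<nu>) * norm (x - p)"
      using d\<phi> unfolding has_derivative_at_alt by blast
    show ?thesis
    proof (intro exI[of _ "min d r"] conjI ballI impI)
      show "0 < min d r" using \<open>d > 0\<close> \<open>r > 0\<close> by simp
      fix x assume x: "x \<in> frontier S" "dist x p < min d r"
      then have "\<phi> x = 0" using fr[of x] by (simp add: \<phi>_def B_def dist_commute)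
      then have "\<bar>\<nu> \<bullet> (x - p)\<bar> \<le> (e * dist x p) * norm \<nu>"
        using d[of x] x \<open>\<phi> p = 0\<close> by (simp add: dist_norm mult_ac)
      then show "\<bar>inward_unit_normal S p \<bullet> (x - p)\<bar> \<le> e * dist x p"
        using pos by (simp add: normal abs_mult field_simps)
    qed
  qed
qed

section \<open>The interior strong maximum principle\<close>

lemma locally_bounded_on_eventually_le:
  fixes f :: "'a::metric_space \<Rightarrow> 'b::real_normed_vector"
  assumes "locally_bounded_on S f" "x \<in> S"
  obtains B where "0 \<le> B" "\<forall>\<^sub>F y in nhds x. y \<in> S \<longrightarrow> norm (f y) \<le> B"
proof -
  obtain r where "r > 0" "bounded (f ` (S \<inter> ball x r))"
    using assms unfolding locally_bounded_on_def by blast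
  then obtain B where B: "\<And>y. y \<in> S \<Longrightarrow> dist x y < r \<Longrightarrow> norm (f y) \<le> B"
    unfolding bounded_iff by force
  have "0 \<le> B" using B[OF \<open>x \<in> S\<close>] \<open>r > 0\<close> by (simp add: order_trans[OF norm_ge_zero])
  moreover have "\<forall>\<^sub>F y in nhds x. y \<in> S \<longrightarrow> norm (f y) \<le> B"
    unfolding eventually_nhds_metric using B \<open>r > 0\<close> by (metis dist_commute)
  ultimately show ?thesis by (rule that)
qed

lemma locally_uniformly_elliptic:
  fixes a :: "real^'n \<Rightarrow> real^'n^'n"
  assumes psd: "\<And>x. x \<in> S \<Longrightarrow> nonneg_definite_symmetric (a x)"
    and "0 < lsc_envelope S (\<lambda>y. smallest_eigenvalue (a y)) z"
  obtains l where "0 < l" "\<forall>\<^sub>F x in nhds z. x \<in> S \<longrightarrow> (\<forall>v::real^'n. l * (v \<bullet> v) \<le> v \<bullet> (a x *v v))"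
proof -
  obtain l where l: "0 < ereal l"
      "ereal l < Liminf (inf (nhds z) (principal S)) (\<lambda>y. ereal (smallest_eigenvalue (a y)))"
    using ereal_dense2 assms(2) unfolding lsc_envelope_def by blast
  have "\<forall>\<^sub>F x in nhds z. x \<in> S \<longrightarrow> l < smallest_eigenvalue (a x)"
    using less_LiminfD[OF l(2)] by (simp add: eventually_inf_principal)
  then have "\<forall>\<^sub>F x in nhds z. x \<in> S \<longrightarrow> (\<forall>v::real^'n. l * (v \<bullet> v) \<le> v \<bullet> (a x *v v))"
  proof eventually_elim
    case (elim x)
    show ?case
    proof (intro impI allI)
      fix v :: "real^'n" assume "x \<in> S"
      then have "l * (v \<bullet> v) \<le> smallest_eigenvalue (a x) * (v \<bullet> v)"
        using elim by (intro mult_right_mono) auto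
      also have "\<dots> \<le> v \<bullet> (a x *v v)"
        using psd[OF \<open>x \<in> S\<close>] by (intro smallest_eigenvalue_le_Rayleigh)
          (simp add: nonneg_definite_symmetric_def)
      finally show "l * (v \<bullet> v) \<le> v \<bullet> (a x *v v)" .
    qed
  qed
  then show ?thesis using that l(1) by simp
qed

text \<open>This is the core of Hopf's argument. The barrier at \<open>z\<close> uses the unit vector \<open>n\<close> towards the
  centre \<open>y\<close>. With \<open>L = 2 / R\<close> its nonnegativity set lies, near \<open>z\<close>, in the open ball together with
  the point \<open>z\<close>, so \<open>z\<close> is the only contact point. By ellipticity a large \<open>K\<close> makes the barrier a
  strict subsolution near \<open>z\<close>. Local bounds on the coefficients suffice there: the first-order term is
  bounded because the gradient at \<open>z\<close> does not depend on \<open>K\<close>, and the zeroth-order term is small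
  because the barrier vanishes at \<open>z\<close>.\<close>
lemma no_contact_with_interior_ball:
  fixes S :: "(real^'n) set" and u :: "real^'n \<Rightarrow> real"
  assumes "open S" and psd: "\<And>x. x \<in> S \<Longrightarrow> nonneg_definite_symmetric (a x)"
    and a: "locally_bounded_on S a" and b: "locally_bounded_on S b" and c: "locally_bounded_on S c"
    and ell: "\<And>x. x \<in> S \<Longrightarrow> 0 < lsc_envelope S (\<lambda>y. smallest_eigenvalue (a y)) x"
    and c0: "\<And>x. x \<in> S \<Longrightarrow> 0 \<le> c x"
    and u: "C2_on S u"
    and sub: "\<And>x. x \<in> S \<Longrightarrow> c x * (u x - M) \<le> trace (a x ** hessian u x) + b x \<bullet> grad u x"
    and M: "\<And>x. x \<in> S \<Longrightarrow> u x \<le> M"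
    and z: "z \<in> S" "u z = M" and "0 < R" "dist y z = R"
    and below: "\<And>x. x \<in> S \<Longrightarrow> dist y x < R \<Longrightarrow> u x \<noteq> M"
  shows False
proof -
  obtain l where "0 < l" and
    l: "\<forall>\<^sub>F x in nhds z. x \<in> S \<longrightarrow> (\<forall>v. l * (v \<bullet> v) \<le> v \<bullet> (a x *v v))"
    by (rule locally_uniformly_elliptic[OF psd ell[OF z(1)]])
  obtain A where "0 \<le> A" and A: "\<forall>\<^sub>F x in nhds z. x \<in> S \<longrightarrow> norm (a x) \<le> A"
    by (rule locally_bounded_on_eventually_le[OF a z(1)])
  obtain B where "0 \<le> B" and B: "\<forall>\<^sub>F x in nhds z. x \<in> S \<longrightarrow> norm (b x) \<le> B"
    by (rule locally_bounded_on_eventually_le[OF b z(1)])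
  obtain C where "0 \<le> C" and C: "\<forall>\<^sub>F x in nhds z. x \<in> S \<longrightarrow> norm (c x) \<le> C"
    by (rule locally_bounded_on_eventually_le[OF c z(1)])
  define T where "T = real CARD('n) * A"
  define n where "n = (y - z) /\<^sub>R R"
  define L where "L = 2 / R"
  \<comment> \<open>\<open>2 K l\<close> is the sum of the bounds \<open>2 L T\<close>, \<open>2 B\<close> and \<open>1\<close> for the other terms, the last of them strict\<close>
  define K where "K = (2 * L * T + 2 * B + 1) / (2 * l)"
  have "0 \<le> T" "0 < L" using \<open>0 \<le> A\<close> \<open>0 < R\<close> by (auto simp: T_def L_def)
  then have "0 < K" using \<open>0 < l\<close> \<open>0 \<le> B\<close>
    by (simp add: K_def add_nonneg_pos)
  have Kl: "2 * K * l = 2 * L * T + 2 * B + 1" using \<open>0 < l\<close> by (simp add: K_def)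
  have nn: "norm n = 1" using \<open>dist y z = R\<close> \<open>0 < R\<close> by (simp add: n_def dist_norm)
  then have n: "n \<bullet> n = 1" by (simp add: norm_eq_1)
  define w where "w = barrier n K L z"
  define G where "G = barrier_grad n K L z"
  have "isCont w z" "isCont G z"
    unfolding w_def G_def
    by (rule has_derivative_continuous[OF barrier_has_derivative]
        has_derivative_continuous[OF barrier_grad_has_derivative])+
  moreover have "w z = 0" "G z = n" by (auto simp: w_def G_def barrier_def barrier_grad_def)
  ultimately have "(w \<longlongrightarrow> 0) (nhds z)" "(G \<longlongrightarrow> n) (nhds z)"
    using continuous_within_topological by (auto simp: isCont_def tendsto_nhds_iff)
  then have w0: "\<forall>\<^sub>F x in nhds z. C * \<bar>w x\<bar> < 1" and G0: "\<forall>\<^sub>F x in nhds z. norm (G x) < 2"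
    using tendsto_mult_right[OF tendsto_rabs, of w 0 "nhds z" C] tendsto_norm[of G n "nhds z"] nn
    by (auto simp: order_tendsto_iff mult.commute)
  have "((\<lambda>x. K * \<bar>n \<bullet> (x - z)\<bar>) \<longlongrightarrow> K * \<bar>n \<bullet> (z - z)\<bar>) (nhds z)"
    by (intro tendsto_intros filterlim_ident)
  then have s0: "\<forall>\<^sub>F x in nhds z. K * \<bar>n \<bullet> (x - z)\<bar> < 1"
    by (simp add: order_tendsto_iff)
  have "\<forall>\<^sub>F x in nhds z. x \<in> S" using \<open>open S\<close> z(1) by (rule eventually_nhds_in_open)
  then have "\<forall>\<^sub>F x in nhds z. x \<in> S \<and> K * \<bar>n \<bullet> (x - z)\<bar> < 1 \<and>
      0 < trace (a x ** barrier_hessian n K L) + b x \<bullet> G x - c x * w x"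
    using l A B C w0 G0 s0
  proof eventually_elim
    case (elim x)
    have a': "l * (n \<bullet> n) \<le> n \<bullet> (a x *v n)" "norm (a x) \<le> A"
      and b': "norm (b x) \<le> B" "norm (G x) \<le> 2" and c': "\<bar>c x\<bar> \<le> C" "C * \<bar>w x\<bar> < 1"
      using elim(1) elim(2)[rule_format, OF elim(1), of n] elim(3-7) by simp_all
    have "\<bar>trace (a x)\<bar> \<le> T"
      unfolding T_def by (rule order_trans[OF abs_trace_le mult_left_mono[OF a'(2)]]) simp
    then have "L * trace (a x) \<le> L * T" using \<open>0 < L\<close> by (intro mult_left_mono) simp_all
    moreover have "2 * K * l \<le> 2 * K * (n \<bullet> (a x *v n))"
      using a'(1) n \<open>0 < K\<close> by (intro mult_left_mono) simp_all
    moreover have "\<bar>b x \<bullet> G x\<bar> \<le> B * 2"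
      using Cauchy_Schwarz_ineq2 mult_mono[OF b' \<open>0 \<le> B\<close> norm_ge_zero] by (rule order_trans)
    moreover have "\<bar>c x * w x\<bar> < 1"
      unfolding abs_mult by (rule le_less_trans[OF mult_right_mono[OF c'(1) abs_ge_zero] c'(2)])
    ultimately have "0 < 2 * K * (n \<bullet> (a x *v n)) - 2 * (L * trace (a x)) + b x \<bullet> G x - c x * w x"
      using Kl by linarith
    then show ?case using elim(1,8) by (simp add: trace_mult_barrier_hessian mult.assoc)
  qed
  then obtain d where "d > 0" and d: "\<And>x. dist x z < d \<Longrightarrow> x \<in> S \<and> K * \<bar>n \<bullet> (x - z)\<bar> < 1 \<and>
      0 < trace (a x ** barrier_hessian n K L) + b x \<bullet> G x - c x * w x"
    unfolding eventually_nhds_metric by blast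
  define Q where "Q = cball z (d / 2)"
  have Q: "dist x z < d" if "x \<in> Q" for x
    using that \<open>d > 0\<close> by (simp add: Q_def dist_commute)
  have contact: "x = z" if "x \<in> Q" "u x = M" "0 \<le> w x" for x
  proof -
    define s where "s = n \<bullet> (x - z)"
    define e where "e = (x - z) \<bullet> (x - z)"
    have "0 \<le> e" by (simp add: e_def)
    have "x \<in> S" and Ks: "K * \<bar>s\<bar> < 1" using d[OF Q[OF that(1)]] by (auto simp: s_def)
    then have "R \<le> norm (x - y)"
      using below[of x] that(2) by (metis dist_norm dist_commute not_le)
    then have "R\<^sup>2 \<le> (x - y) \<bullet> (x - y)"
      using \<open>0 < R\<close> by (simp add: power2_norm_eq_inner[symmetric])
    moreover have "x - y = (x - z) - R *\<^sub>R n" using \<open>0 < R\<close> by (simp add: n_def)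
    ultimately have "R\<^sup>2 \<le> e - 2 * R * s + R\<^sup>2"
      by (simp add: inner_diff inner_commute n s_def e_def power2_eq_square algebra_simps)
    \<comment> \<open>outside the ball \<open>s\<close> is at most \<open>e / (2 R)\<close>; nonnegativity of \<open>w\<close> with \<open>s > 0\<close> makes it at least twice as large\<close>
    then have ball: "2 * R * s \<le> e" by simp
    have "L * e \<le> s + K * s\<^sup>2" using that(3) by (simp add: w_def barrier_def s_def e_def)
    also have "\<dots> = s * (1 + K * s)" by (simp add: power2_eq_square algebra_simps)
    finally have Le: "2 * e \<le> R * (s * (1 + K * s))" using \<open>0 < R\<close> by (simp add: L_def field_simps)
    have "e \<le> 0"
    proof (cases "s \<le> 0")
      case True
      then have "0 \<le> 1 + K * s" using Ks by simp
      then have "R * (s * (1 + K * s)) \<le> 0"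
        using True \<open>0 < R\<close> by (simp add: mult_le_0_iff)
      then show ?thesis using Le by simp
    next
      case False
      then have "s * (1 + K * s) \<le> s * 2" using Ks by (intro mult_left_mono) auto
      then have "R * (s * (1 + K * s)) \<le> R * (s * 2)" using \<open>0 < R\<close> by simp
      then show ?thesis using Le ball by simp
    qed
    then have "e = 0" using \<open>0 \<le> e\<close> by simp
    then show "x = z" unfolding e_def by simp
  qed
  have contu: "continuous_on S u"
    using u unfolding C2_on_def by (meson differentiable_at_imp_differentiable_on differentiable_imp_continuous_on)
  have "z \<in> Q" using \<open>d > 0\<close> by (simp add: Q_def)
  obtain q where q: "q \<in> Q" "u q = M" "0 \<le> w q"
    and near: "\<And>N. open N \<Longrightarrow> q \<in> N \<Longrightarrow>
      \<exists>\<epsilon>>0. \<exists>p\<in>Q \<inter> N. \<forall>x\<in>Q. u x + \<epsilon> * w x \<le> u p + \<epsilon> * w p"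
  proof (rule perturbed_maximum_near_contact[of Q u w M z])
    show "compact Q" by (simp add: Q_def)
    show "continuous_on Q u" using contu by (rule continuous_on_subset) (use Q d in blast)
    show "continuous_on Q w" unfolding w_def by (rule continuous_on_barrier)
    show "u x \<le> M" if "x \<in> Q" for x using M d Q that by blast
  qed (use \<open>z \<in> Q\<close> z \<open>w z = 0\<close> in auto)
  have "q = z" using contact q by blast
  then obtain \<epsilon> p where "0 < \<epsilon>" and p: "p \<in> ball z (d / 2)"
    and max: "\<And>x. x \<in> Q \<Longrightarrow> u x + \<epsilon> * w x \<le> u p + \<epsilon> * w p"
    using near[of "ball z (d / 2)"] \<open>d > 0\<close> by auto
  have "p \<in> Q" using p by (simp add: Q_def)
  note dp = d[OF Q[OF this]]
  show False
  proof (rule no_maximum_of_strict_perturbation[OF \<open>open S\<close> _ u psd c0 \<open>0 < \<epsilon>\<close> sub, of p w G])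
    show "(w has_derivative (\<lambda>h. G x \<bullet> h)) (at x)" for x
      unfolding w_def G_def by (rule barrier_has_derivative)
    show "(G has_derivative (\<lambda>h. barrier_hessian n K L *v h)) (at p)"
      unfolding G_def by (rule barrier_grad_has_derivative)
    show "0 < trace (a p ** barrier_hessian n K L) + b p \<bullet> G p - c p * w p" using dp by simp
    have "\<forall>\<^sub>F x in nhds p. x \<in> ball z (d / 2)" using p by (intro eventually_nhds_in_open) auto
    then show "\<forall>\<^sub>F x in nhds p. u x + \<epsilon> * w x \<le> u p + \<epsilon> * w p"
      by eventually_elim (auto simp: Q_def intro!: max)
    show "M \<le> u p + \<epsilon> * w p" using max[OF \<open>z \<in> Q\<close>] z(2) \<open>w z = 0\<close> by simp
  qed (use dp in auto)
qed

text \<open>If the set where \<open>u = M\<close> were not open in \<open>S\<close>, a point \<open>y\<close> outside it but close to it would be the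
  centre of a ball in \<open>S\<close> that touches this set at a nearest point, which the previous lemma
  excludes.\<close>
lemma interior_strong_maximum_principle:
  fixes S :: "(real^'n) set" and u :: "real^'n \<Rightarrow> real"
  assumes "open S" "connected S" and psd: "\<And>x. x \<in> S \<Longrightarrow> nonneg_definite_symmetric (a x)"
    and a: "locally_bounded_on S a" and b: "locally_bounded_on S b" and c: "locally_bounded_on S c"
    and ell: "\<And>x. x \<in> S \<Longrightarrow> 0 < lsc_envelope S (\<lambda>y. smallest_eigenvalue (a y)) x"
    and c0: "\<And>x. x \<in> S \<Longrightarrow> 0 \<le> c x"
    and u: "C2_on S u"
    and sub: "\<And>x. x \<in> S \<Longrightarrow> c x * (u x - M) \<le> trace (a x ** hessian u x) + b x \<bullet> grad u x"
    and M: "\<And>x. x \<in> S \<Longrightarrow> u x \<le> M"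
    and attained: "x\<^sub>0 \<in> S" "u x\<^sub>0 = M" and "x \<in> S"
  shows "u x = M"
proof -
  define Z where "Z = {x \<in> S. u x = M}"
  have contu: "continuous_on S u"
    using u unfolding C2_on_def by (meson differentiable_at_imp_differentiable_on differentiable_imp_continuous_on)
  have "open Z"
    unfolding open_contains_ball
  proof (rule ballI, rule ccontr)
    fix z assume "z \<in> Z" and no_ball: "\<not> (\<exists>e>0. ball z e \<subseteq> Z)"
    then have "z \<in> S" by (simp add: Z_def)
    then obtain e where "e > 0" and e: "cball z e \<subseteq> S"
      using \<open>open S\<close> open_contains_cball by blast
    obtain y where y: "dist z y < e / 2" "y \<notin> Z"
      using no_ball \<open>e > 0\<close> by (metis half_gt_zero mem_ball subsetI)
    define Y where "Y = {x \<in> cball z e. u x = M}"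
    have "closed Y" unfolding Y_def
      using contu e by (intro continuous_closed_preimage_constant) (auto intro: continuous_on_subset)
    have "z \<in> Y" using \<open>z \<in> Z\<close> \<open>e > 0\<close> by (simp add: Y_def Z_def)
    then obtain z' where z': "z' \<in> Y" and min: "\<And>x. x \<in> Y \<Longrightarrow> dist y z' \<le> dist y x"
      using distance_attains_inf[OF \<open>closed Y\<close>, of y] by blast
    have "dist y z' < e / 2" using min[OF \<open>z \<in> Y\<close>] y by (simp add: dist_commute)
    have "z' \<in> S" "u z' = M" using z' e by (auto simp: Y_def)
    have "y \<in> S" using y(1) e \<open>e > 0\<close> by (intro subsetD[OF e]) simp
    then have "z' \<noteq> y" using y(2) \<open>u z' = M\<close> by (auto simp: Z_def)
    show False
    proof (rule no_contact_with_interior_ball[OF \<open>open S\<close> psd a b c ell c0 u sub M \<open>z' \<in> S\<close> \<open>u z' = M\<close>, of "dist y z'" y])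
      show "0 < dist y z'" using \<open>z' \<noteq> y\<close> by simp
      fix x assume x: "dist y x < dist y z'"
      have "dist z x \<le> e"
        using dist_triangle[of z x y] x y(1) \<open>dist y z' < e / 2\<close> by simp
      then show "u x \<noteq> M" using min[of x] x by (auto simp: Y_def)
    qed auto
  qed
  then have "openin (top_of_set S) Z" by (intro open_subset) (auto simp: Z_def)
  moreover have "closedin (top_of_set S) Z"
    unfolding Z_def by (rule continuous_closedin_preimage_constant[OF contu])
  moreover have "Z \<noteq> {}" using attained by (auto simp: Z_def)
  ultimately have "Z = S" using \<open>connected S\<close> unfolding connected_clopen by blast
  then show ?thesis using \<open>x \<in> S\<close> by (auto simp: Z_def)
qed

section \<open>Maxima on the degenerate boundary\<close>

lemma degenerate_boundary_subset_frontier: "degenerate_boundary S a \<subseteq> frontier S"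
  unfolding degenerate_boundary_def using interior_of_subset by fast

lemma degenerate_boundary_disjoint:
  "open S \<Longrightarrow> x \<in> degenerate_boundary S a \<Longrightarrow> x \<notin> S"
  using degenerate_boundary_subset_frontier[of S a] by (auto simp: frontier_def interior_open)

lemma degenerate_boundary_tendsto_0:
  "x \<in> degenerate_boundary S a \<Longrightarrow> (a \<longlongrightarrow> 0) (at x within S)"
  unfolding degenerate_boundary_def using interior_of_subset by fast

lemma eventually_closure_in_domain_with_boundary:
  assumes "open S" "z \<in> degenerate_boundary S a"
  shows "\<forall>\<^sub>F x in nhds z. x \<in> closure S \<longrightarrow> x \<in> domain_with_boundary S a"
proof -
  have "openin (top_of_set (frontier S)) (degenerate_boundary S a)"
    unfolding degenerate_boundary_def by (rule openin_interior_of)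
  then obtain U where "open U" and U: "degenerate_boundary S a = frontier S \<inter> U"
    unfolding openin_open by blast
  then have "\<forall>\<^sub>F x in nhds z. x \<in> U" using assms(2) by (intro eventually_nhds_in_open) auto
  then show ?thesis
    by eventually_elim
      (use assms(1) in \<open>auto simp: domain_with_boundary_def U frontier_def interior_open\<close>)
qed

text \<open>The degenerate boundary carries a condition of its own: since \<open>tr (a D\<^sup>2u)\<close> tends to 0 at \<open>p\<close>, the
  differential inequality becomes the first-order inequality \<open>b \<bullet> Du - c (u - M) \<ge> 0\<close> in the
  limit. If the perturbation \<open>w\<close> satisfies it strictly, the derivative of \<open>u + \<epsilon> w\<close> along \<open>b p\<close> is
  positive. But \<open>b p\<close> points into \<open>S\<close>, so \<open>u + \<epsilon> w\<close> increases from \<open>p\<close> into \<open>S\<close>. As \<open>c\<close> may be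
  discontinuous at \<open>p\<close>, its bound \<open>C\<close> takes its place in the limit.\<close>
lemma no_boundary_maximum_of_strict_perturbation:
  fixes S D :: "(real^'n) set" and a :: "real^'n \<Rightarrow> real^'n^'n" and u w :: "real^'n \<Rightarrow> real"
  assumes "S \<subseteq> D" and p: "p \<in> D" and inward: "\<forall>\<^sub>F t in at_right 0. p + t *\<^sub>R b p \<in> S"
    and bp: "continuous (at p within D) b"
    and c0: "\<And>x. x \<in> S \<Longrightarrow> 0 \<le> c x" and C: "\<forall>\<^sub>F x in nhds p. x \<in> S \<longrightarrow> c x \<le> C"
    and u: "C1_up_to S D u" "continuous_on D u"
    and g: "continuous_on D g" "\<And>x. x \<in> S \<Longrightarrow> g x = grad u x"
    and h: "continuous_on D h" "\<And>x. x \<in> S \<Longrightarrow> h x = trace (a x ** hessian u x)" "h p = 0"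
    and sub: "\<And>x. x \<in> S \<Longrightarrow> c x * (u x - M) \<le> trace (a x ** hessian u x) + b x \<bullet> grad u x"
    and w: "\<And>x. (w has_derivative (\<lambda>h. G x \<bullet> h)) (at x)" and G: "continuous_on UNIV G"
    and "0 < \<epsilon>" "0 \<le> w p" and strict: "0 < b p \<bullet> G p - C * w p"
    and max: "\<forall>\<^sub>F x in nhds p. x \<in> S \<longrightarrow> u x + \<epsilon> * w x \<le> u p + \<epsilon> * w p"
    and M: "M \<le> u p + \<epsilon> * w p"
  shows False
proof -
  define \<l> where "\<l> t = p + t *\<^sub>R b p" for t
  define m where "m = (g p + \<epsilon> *\<^sub>R G p) \<bullet> b p"
  have "(\<l> \<longlongrightarrow> p + 0 *\<^sub>R b p) (at_right 0)" unfolding \<l>_def by (intro tendsto_intros)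
  then have \<l>0: "(\<l> \<longlongrightarrow> p) (at_right 0)" by simp
  have inS: "\<forall>\<^sub>F t in at_right 0. \<l> t \<in> S" using inward by (simp add: \<l>_def)
  have comp: "((\<lambda>t. f (\<l> t)) \<longlongrightarrow> f p) (at_right 0)"
    if "continuous (at p within D) f" for f :: "real^'n \<Rightarrow> 'c::metric_space"
  proof -
    have "\<forall>\<^sub>F t in at_right 0. \<l> t \<in> D" using inS \<open>S \<subseteq> D\<close> by (auto elim: eventually_mono)
    from continuous_within_tendsto_compose[OF that this \<l>0] show ?thesis .
  qed
  have comp_on: "((\<lambda>t. f (\<l> t)) \<longlongrightarrow> f p) (at_right 0)"
    if "continuous_on D f" for f :: "real^'n \<Rightarrow> 'c::metric_space"
    using that p by (intro comp) (simp add: continuous_on_eq_continuous_within)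
  have "continuous_on D G" using G continuous_on_subset by blast
  note lim = comp[OF bp] comp_on[OF u(2)] comp_on[OF g(1)] comp_on[OF h(1)] comp_on[OF this]
  have C': "\<forall>\<^sub>F t in at_right 0. \<l> t \<in> S \<longrightarrow> c (\<l> t) \<le> C"
    by (rule eventually_compose_filterlim[OF C \<l>0])
  have max': "\<forall>\<^sub>F t in at_right 0. \<l> t \<in> S \<longrightarrow> u (\<l> t) + \<epsilon> * w (\<l> t) \<le> u p + \<epsilon> * w p"
    by (rule eventually_compose_filterlim[OF max \<l>0])
  \<comment> \<open>the limit of the differential inequality along the segment \<open>\<l>\<close>; the first term on the left is 0\<close>
  have "- (C * \<bar>u p - u p\<bar>) - \<epsilon> * (C * w p) \<le> h p + b p \<bullet> g p"
  proof (rule tendsto_le)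
    show "((\<lambda>t. h (\<l> t) + b (\<l> t) \<bullet> g (\<l> t)) \<longlongrightarrow> h p + b p \<bullet> g p) (at_right 0)"
      by (intro tendsto_intros lim)
    show "((\<lambda>t. - (C * \<bar>u (\<l> t) - u p\<bar>) - \<epsilon> * (C * w p)) \<longlongrightarrow> - (C * \<bar>u p - u p\<bar>) - \<epsilon> * (C * w p)) (at_right 0)"
      by (intro tendsto_intros lim)
    show "\<forall>\<^sub>F t in at_right 0. - (C * \<bar>u (\<l> t) - u p\<bar>) - \<epsilon> * (C * w p)
        \<le> h (\<l> t) + b (\<l> t) \<bullet> g (\<l> t)"
      using inS C'
    proof eventually_elim
      case (elim t)
      define x where "x = \<l> t"
      have x: "0 \<le> c x" "c x \<le> C" "x \<in> S" using elim c0 by (auto simp: x_def)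
      have "c x * \<bar>u x - u p\<bar> \<le> C * \<bar>u x - u p\<bar>" using x by (intro mult_right_mono) auto
      moreover have "c x * - \<bar>u x - u p\<bar> \<le> c x * (u x - u p)" using x by (intro mult_left_mono) auto
      moreover have "c x * (M - u p) \<le> c x * (\<epsilon> * w p)" using x M by (intro mult_left_mono) auto
      moreover have "c x * (\<epsilon> * w p) \<le> C * (\<epsilon> * w p)"
        using x \<open>0 < \<epsilon>\<close> \<open>0 \<le> w p\<close> by (intro mult_right_mono) auto
      ultimately have "- (C * \<bar>u x - u p\<bar>) - \<epsilon> * (C * w p) \<le> c x * (u x - M)"
        by (simp add: algebra_simps)
      then show ?case using sub[OF x(3)] g(2)[OF x(3)] h(2)[OF x(3)] by (simp add: x_def)
    qed
  qed simp
  then have "- (\<epsilon> * (C * w p)) \<le> b p \<bullet> g p" using h(3) by simp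
  moreover have "0 < \<epsilon> * (b p \<bullet> G p - C * w p)" using strict \<open>0 < \<epsilon>\<close> by simp
  ultimately have "0 < m" by (simp add: m_def inner_add_left inner_commute algebra_simps)
  moreover have "((\<lambda>t. (g (\<l> t) + \<epsilon> *\<^sub>R G (\<l> t)) \<bullet> b p) \<longlongrightarrow> m) (at_right 0)"
    unfolding m_def by (intro tendsto_intros lim)
  ultimately have "\<forall>\<^sub>F t in at_right 0. 0 < (g (\<l> t) + \<epsilon> *\<^sub>R G (\<l> t)) \<bullet> b p"
    by (simp add: order_tendsto_iff)
  with inS max' have "\<forall>\<^sub>F t in at_right 0. \<l> t \<in> S \<and> u (\<l> t) + \<epsilon> * w (\<l> t) \<le> u p + \<epsilon> * w p
      \<and> 0 < (g (\<l> t) + \<epsilon> *\<^sub>R G (\<l> t)) \<bullet> b p"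
    by eventually_elim auto
  then obtain d where "d > 0" and d: "\<And>t. 0 < t \<Longrightarrow> t < d \<Longrightarrow>
      \<l> t \<in> S \<and> u (\<l> t) + \<epsilon> * w (\<l> t) \<le> u p + \<epsilon> * w p \<and> 0 < (g (\<l> t) + \<epsilon> *\<^sub>R G (\<l> t)) \<bullet> b p"
    unfolding eventually_at_right_field by auto
  have "\<l> 0 = p" by (simp add: \<l>_def)
  have "u (\<l> 0) + \<epsilon> * w (\<l> 0) < u (\<l> (d/2)) + \<epsilon> * w (\<l> (d/2))"
  proof (rule DERIV_pos_imp_increasing_open[of 0 "d/2" "\<lambda>t. u (\<l> t) + \<epsilon> * w (\<l> t)"])
    show "0 < d / 2" using \<open>d > 0\<close> by simp
    fix t assume t: "0 < t" "t < d / 2"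
    then have "\<l> t \<in> S" and pos: "0 < (g (\<l> t) + \<epsilon> *\<^sub>R G (\<l> t)) \<bullet> b p" using d[of t] by auto
    then have "(u has_derivative (\<lambda>h. g (\<l> t) \<bullet> h)) (at (\<l> t))"
      using u(1) g(2) grad_has_derivative unfolding C1_up_to_def by metis
    from has_derivative_add[OF this has_derivative_mult_right[OF w, of \<epsilon>]]
    have v: "((\<lambda>x. u x + \<epsilon> * w x) has_derivative (\<lambda>h. (g (\<l> t) + \<epsilon> *\<^sub>R G (\<l> t)) \<bullet> h)) (at (\<l> t))"
      by (simp add: inner_add_left)
    have "(\<l> has_derivative (\<lambda>s. s *\<^sub>R b p)) (at t)"
      unfolding \<l>_def by (auto intro!: derivative_eq_intros)
    from has_derivative_compose[OF this v]
    have "((\<lambda>t. u (\<l> t) + \<epsilon> * w (\<l> t)) has_real_derivative (g (\<l> t) + \<epsilon> *\<^sub>R G (\<l> t)) \<bullet> b p) (at t)"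
      by (simp add: has_field_derivative_def mult.commute[of _ "(g (\<l> t) + \<epsilon> *\<^sub>R G (\<l> t)) \<bullet> b p"])
    then show "\<exists>y. ((\<lambda>t. u (\<l> t) + \<epsilon> * w (\<l> t)) has_real_derivative y) (at t) \<and> 0 < y"
      using pos by blast
  next
    have "continuous_on D (\<lambda>x. u x + \<epsilon> * w x)"
      using w by (intro continuous_intros u(2) has_derivative_continuous_on[OF has_derivative_at_withinI])
    moreover have "continuous_on {0..d/2} \<l>" unfolding \<l>_def by (intro continuous_intros)
    moreover have "\<l> t \<in> D" if "t \<in> {0..d/2}" for t
      using that p \<open>\<l> 0 = p\<close> d[of t] \<open>S \<subseteq> D\<close> \<open>d > 0\<close> by (cases "t = 0") auto
    then have "\<l> ` {0..d/2} \<subseteq> D" by blast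
    ultimately show "continuous_on {0..d/2} (\<lambda>t. u (\<l> t) + \<epsilon> * w (\<l> t))"
      by (rule continuous_on_compose2)
  qed
  then show False using d[of "d / 2"] \<open>\<l> 0 = p\<close> \<open>d > 0\<close> by simp
qed

text \<open>The barrier at \<open>z\<close> has the inward unit normal \<open>n\<close> as gradient, \<open>K = 0\<close> and \<open>L = \<theta> / r\<close> on the ball
  of radius \<open>r\<close>. Its gradient deviates from \<open>n\<close> by at most \<open>2 \<theta>\<close> on the ball, so with a small \<open>\<theta>\<close>
  (independent of \<open>r\<close>) the field \<open>b\<close> still increases it, by \<open>b z \<bullet> n > 0\<close>. On the other hand it is at
  most \<open>\<theta> r / 2 - \<theta> r < 0\<close> where the frontier meets the sphere of radius \<open>r\<close>, if \<open>r\<close> is small, as the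
  frontier leaves its tangent plane by \<open>o(r)\<close> only. So the contact point \<open>q\<close>, which lies on the
  degenerate boundary by \<open>u \<noteq> M\<close> on \<open>S\<close>, is inside the ball. Near \<open>q\<close> the matrix \<open>a\<close> is so small
  that the barrier is a strict subsolution although \<open>L\<close> is large. A maximum of \<open>u + \<epsilon> w\<close>
  near \<open>q\<close> is then impossible, both in \<open>S\<close> and on the degenerate boundary.\<close>
lemma no_maximum_on_degenerate_boundary:
  fixes S :: "(real^'n) set" and a :: "real^'n \<Rightarrow> real^'n^'n" and u :: "real^'n \<Rightarrow> real"
  defines "D \<equiv> domain_with_boundary S a" and "T \<equiv> degenerate_boundary S a"
  assumes "open S" and psd: "\<And>x. x \<in> S \<Longrightarrow> nonneg_definite_symmetric (a x)"
    and normal: "\<And>x. x \<in> T \<Longrightarrow> 0 < normal_component S b x"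
    and c0: "\<And>x. x \<in> S \<Longrightarrow> 0 \<le> c x"
    and c: "locally_bounded_on D c"
    and b: "\<And>x. x \<in> T \<Longrightarrow> continuous (at x within D) b"
    and portion: "C1_Hoelder_boundary_portion \<alpha> S T"
    and u: "u \<in> C2s S a"
    and sub: "\<And>x. x \<in> S \<Longrightarrow> c x * (u x - M) \<le> trace (a x ** hessian u x) + b x \<bullet> grad u x"
    and M: "\<And>x. x \<in> D \<Longrightarrow> u x \<le> M" and below: "\<And>x. x \<in> S \<Longrightarrow> u x \<noteq> M"
    and z: "z \<in> T" "u z = M"
  shows False
proof -
  have u2: "C2_on S u" and u1: "C1_up_to S D u" and contu: "continuous_on D u"
    using u by (auto simp: C2s_def D_def C1_up_to_def)
  obtain g where g: "continuous_on D g" "\<And>x. x \<in> S \<Longrightarrow> g x = grad u x"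
    using u1 unfolding C1_up_to_def by blast
  obtain h where h: "continuous_on D h" "\<And>x. x \<in> S \<Longrightarrow> h x = trace (a x ** hessian u x)"
    "\<And>x. x \<in> T \<Longrightarrow> h x = 0"
    using u unfolding C2s_def D_def T_def by blast
  have DT: "D = S \<union> T" by (simp add: D_def T_def domain_with_boundary_def)
  define n where "n = inward_unit_normal S z"
  have nn: "norm n = 1"
    unfolding n_def by (rule C1_Hoelder_boundary_portion_normal(1)[OF \<open>open S\<close> portion z(1)])
  define \<beta> where "\<beta> = b z \<bullet> n"
  have "0 < \<beta>" using normal[OF z(1)] by (simp add: \<beta>_def n_def normal_component_def)
  define B where "B = norm (b z) + 1"
  have "1 \<le> B" by (simp add: B_def)
  \<comment> \<open>the factor 16 leaves \<open>3 \<beta> / 8\<close> of the drift \<open>\<beta> / 2\<close>, see \<open>drift\<close> below\<close>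
  define \<theta> where "\<theta> = \<beta> / (16 * B)"
  have "0 < \<theta>" using \<open>0 < \<beta>\<close> \<open>1 \<le> B\<close> by (simp add: \<theta>_def)
  have "z \<in> D" using z DT by simp
  obtain C where "0 \<le> C" and C: "\<forall>\<^sub>F x in nhds z. x \<in> D \<longrightarrow> norm (c x) \<le> C"
    by (rule locally_bounded_on_eventually_le[OF c \<open>z \<in> D\<close>])
  have lim: "(b \<longlongrightarrow> b z) (at z within D)"
    using b[OF z(1)] by (simp add: continuous_within)
  have "\<forall>\<^sub>F x in at z within D. norm (b x) < B \<and> \<beta> / 2 < b x \<bullet> n"
  proof (rule eventually_conj)
    show "\<forall>\<^sub>F x in at z within D. norm (b x) < B"
      by (rule order_tendstoD(2)[OF tendsto_norm[OF lim]]) (simp add: B_def)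
    show "\<forall>\<^sub>F x in at z within D. \<beta> / 2 < b x \<bullet> n"
      by (rule order_tendstoD(1)[OF tendsto_inner[OF lim tendsto_const]]) (use \<open>0 < \<beta>\<close> in \<open>simp add: \<beta>_def\<close>)
  qed
  then have bz: "\<forall>\<^sub>F x in nhds z. x \<in> D \<longrightarrow> norm (b x) < B \<and> \<beta> / 2 < b x \<bullet> n"
    unfolding eventually_at_filter
    by eventually_elim (use \<open>0 < \<beta>\<close> in \<open>auto simp: B_def \<beta>_def\<close>)
  obtain \<delta> where "\<delta> > 0" and \<delta>: "\<And>x. x \<in> frontier S \<Longrightarrow> dist x z < \<delta> \<Longrightarrow>
      \<bar>n \<bullet> (x - z)\<bar> \<le> \<theta> / 2 * dist x z"
    using C1_Hoelder_boundary_portion_normal(2)[OF \<open>open S\<close> portion z(1), of "\<theta> / 2"] \<open>0 < \<theta>\<close>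
    unfolding n_def by auto
  have "\<forall>\<^sub>F x in nhds z. (x \<in> D \<longrightarrow> norm (c x) \<le> C \<and> norm (b x) < B \<and> \<beta> / 2 < b x \<bullet> n)
      \<and> (x \<in> closure S \<longrightarrow> x \<in> D)"
    using C bz eventually_closure_in_domain_with_boundary[OF \<open>open S\<close> z(1)[unfolded T_def]]
    by eventually_elim (auto simp: D_def)
  then obtain r\<^sub>0 where "r\<^sub>0 > 0" and r0: "\<And>x. dist x z < r\<^sub>0 \<Longrightarrow> x \<in> D \<Longrightarrow>
      norm (c x) \<le> C \<and> norm (b x) < B \<and> \<beta> / 2 < b x \<bullet> n"
    and r0D: "\<And>x. dist x z < r\<^sub>0 \<Longrightarrow> x \<in> closure S \<Longrightarrow> x \<in> D"
    unfolding eventually_nhds_metric by blast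
  define r where "r = min (min r\<^sub>0 \<delta> / 2) (\<beta> / (8 * (C + 1)))"
  have r_le: "r \<le> min r\<^sub>0 \<delta> / 2" "r \<le> \<beta> / (8 * (C + 1))"
    unfolding r_def by (rule min.cobounded1, rule min.cobounded2)
  have r: "0 < r" "r < r\<^sub>0" "r < \<delta>"
    using r_le(1) \<open>r\<^sub>0 > 0\<close> \<open>\<delta> > 0\<close> \<open>0 < \<beta>\<close> \<open>0 \<le> C\<close> by (simp add: r_def, linarith+)
  then have "r * (8 * (C + 1)) \<le> \<beta>"
    using r_le(2) \<open>0 \<le> C\<close> by (simp add: pos_le_divide_eq)
  then have Cr: "C * r \<le> \<beta> / 8" using r(1) by (simp add: algebra_simps)
  define L where "L = \<theta> / r"
  have "0 < L" using \<open>0 < \<theta>\<close> r(1) by (simp add: L_def)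
  define w where "w = barrier n 0 L z"
  define G where "G = barrier_grad n 0 L z"
  have drift: "\<beta> / 4 \<le> b x \<bullet> G x - C * w x" if "x \<in> D" "dist x z \<le> r" for x
  proof -
    have bx: "norm (b x) < B" "\<beta> / 2 < b x \<bullet> n" using r0[OF _ that(1)] that(2) r by auto
    have "b x \<bullet> (x - z) \<le> norm (b x) * norm (x - z)" by (rule norm_cauchy_schwarz)
    also have "\<dots> \<le> B * r" using bx that(2) r(1) \<open>1 \<le> B\<close> by (intro mult_mono) (auto simp: dist_norm)
    finally have "2 * L * (b x \<bullet> (x - z)) \<le> 2 * L * (B * r)" using \<open>0 < L\<close> by (intro mult_left_mono) auto
    also have "\<dots> = \<beta> / 8" using r(1) \<open>1 \<le> B\<close> by (simp add: L_def \<theta>_def)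
    finally have "3 * \<beta> / 8 \<le> b x \<bullet> G x"
      using bx by (simp add: G_def barrier_grad_def inner_diff_right)
    moreover have "w x \<le> n \<bullet> (x - z)" using \<open>0 < L\<close> by (simp add: w_def barrier_def)
    then have "w x \<le> r" using norm_cauchy_schwarz[of n "x - z"] nn that(2) by (simp add: dist_norm)
    then have "C * w x \<le> C * r" using \<open>0 \<le> C\<close> by (rule mult_left_mono)
    ultimately show ?thesis using Cr by simp
  qed
  define Q where "Q = closure S \<inter> cball z r"
  have "compact Q" unfolding Q_def by (intro closed_Int_compact) auto
  have QD: "x \<in> D" "dist x z \<le> r" if "x \<in> Q" for x
    using that r r0D[of x] by (auto simp: Q_def dist_commute)
  have "z \<in> Q" using z(1) r(1) degenerate_boundary_subset_frontier[of S a]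
    by (auto simp: Q_def T_def frontier_def)
  have "w z = 0" by (simp add: w_def barrier_def)
  obtain q where q: "q \<in> Q" "u q = M" "0 \<le> w q"
    and near: "\<And>N. open N \<Longrightarrow> q \<in> N \<Longrightarrow>
      \<exists>\<epsilon>>0. \<exists>p\<in>Q \<inter> N. \<forall>x\<in>Q. u x + \<epsilon> * w x \<le> u p + \<epsilon> * w p"
  proof (rule perturbed_maximum_near_contact[of Q u w M z])
    show "continuous_on Q u" using contu by (rule continuous_on_subset) (use QD in blast)
    show "continuous_on Q w" unfolding w_def by (rule continuous_on_barrier)
    show "u x \<le> M" if "x \<in> Q" for x using M QD that by blast
  qed (use \<open>compact Q\<close> \<open>z \<in> Q\<close> z \<open>w z = 0\<close> in auto)
  have "q \<in> T" using below QD[OF q(1)] q(2) DT by auto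
  have "dist q z < r"
  proof (rule ccontr)
    assume "\<not> dist q z < r"
    then have dq: "dist q z = r" using QD[OF q(1)] by simp
    have "q \<in> frontier S" using \<open>q \<in> T\<close> degenerate_boundary_subset_frontier by (auto simp: T_def)
    then have "n \<bullet> (q - z) \<le> \<theta> / 2 * r" using \<delta>[of q] dq r by simp
    moreover have "L * ((q - z) \<bullet> (q - z)) = \<theta> * r"
      using dq r(1) by (simp add: L_def dist_norm power2_norm_eq_inner[symmetric] power2_eq_square)
    moreover have "0 < \<theta> * r" using \<open>0 < \<theta>\<close> r(1) by simp
    ultimately have "w q < 0" by (simp add: w_def barrier_def)
    then show False using q(3) by simp
  qed
  have "q \<notin> S" using degenerate_boundary_disjoint[OF \<open>open S\<close>] \<open>q \<in> T\<close> by (auto simp: T_def)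
  have "((\<lambda>x. 2 * L * trace (a x)) \<longlongrightarrow> 2 * L * trace (0::real^'n^'n)) (at q within S)"
    unfolding trace_def
    using degenerate_boundary_tendsto_0 \<open>q \<in> T\<close> unfolding T_def
    by (intro tendsto_intros) auto
  then have "\<forall>\<^sub>F x in at q within S. 2 * L * trace (a x) < \<beta> / 4"
    using \<open>0 < \<beta>\<close> by (intro order_tendstoD(2)) (auto simp: trace_def)
  then have "\<forall>\<^sub>F x in nhds q. x \<in> S \<longrightarrow> 2 * L * trace (a x) < \<beta> / 4"
    unfolding eventually_at_filter by eventually_elim (use \<open>q \<notin> S\<close> in auto)
  \<comment> \<open>this neighbourhood of \<open>q\<close> depends on \<open>L\<close>, hence on \<open>r\<close>; so it can be chosen only after the ball\<close>
  then obtain U where "open U" "q \<in> U" and U: "\<And>x. x \<in> U \<Longrightarrow> x \<in> S \<Longrightarrow> 2 * L * trace (a x) < \<beta> / 4"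
    unfolding eventually_nhds by blast
  obtain \<epsilon> p where "0 < \<epsilon>" and p: "p \<in> Q" "p \<in> U" "dist p z < r"
    and max: "\<And>x. x \<in> Q \<Longrightarrow> u x + \<epsilon> * w x \<le> u p + \<epsilon> * w p"
    using near[OF open_Int[OF \<open>open U\<close> open_ball[of z r]]] \<open>q \<in> U\<close> \<open>dist q z < r\<close>
    by (auto simp: dist_commute)
  have Mp: "M \<le> u p + \<epsilon> * w p" using max[OF \<open>z \<in> Q\<close>] z(2) \<open>w z = 0\<close> by simp
  have "0 \<le> \<epsilon> * w p" using Mp M[OF QD(1)[OF p(1)]] by simp
  then have wp: "0 \<le> w p" using \<open>0 < \<epsilon>\<close> by (simp add: zero_le_mult_iff)
  have dw: "(w has_derivative (\<lambda>h. G x \<bullet> h)) (at x)" for x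
    unfolding w_def G_def by (rule barrier_has_derivative)
  have ball: "\<forall>\<^sub>F x in nhds p. x \<in> ball z r"
    using p(3) by (intro eventually_nhds_in_open) (auto simp: dist_commute)
  then have max': "\<forall>\<^sub>F x in nhds p. x \<in> S \<longrightarrow> u x + \<epsilon> * w x \<le> u p + \<epsilon> * w p"
    by eventually_elim (auto simp: Q_def intro!: max subsetD[OF closure_subset])
  have Cp: "c x \<le> C" if "x \<in> S" "x \<in> ball z r" for x
    using r0[of x] that r DT by (auto simp: dist_commute)
  show False
  proof (cases "p \<in> S")
    case True
    show False
    proof (rule no_maximum_of_strict_perturbation[OF \<open>open S\<close> True u2 psd c0 \<open>0 < \<epsilon>\<close> sub dw])
      show "(G has_derivative (\<lambda>h. barrier_hessian n 0 L *v h)) (at p)"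
        unfolding G_def by (rule barrier_grad_has_derivative)
      have "c p * w p \<le> C * w p"
        using Cp[OF True] p(3) wp by (intro mult_right_mono) (auto simp: dist_commute)
      then show "0 < trace (a p ** barrier_hessian n 0 L) + b p \<bullet> G p - c p * w p"
        using U[OF p(2) True] drift[OF QD[OF p(1)]] by (simp add: trace_mult_barrier_hessian)
      have "\<forall>\<^sub>F x in nhds p. x \<in> S" using \<open>open S\<close> True by (rule eventually_nhds_in_open)
      with max' show "\<forall>\<^sub>F x in nhds p. u x + \<epsilon> * w x \<le> u p + \<epsilon> * w p"
        by eventually_elim auto
    qed (use Mp True in auto)
  next
    case False
    then have pT: "p \<in> T" using QD[OF p(1)] DT by auto
    show False
    proof (rule no_boundary_maximum_of_strict_perturbation[OF _ QD(1)[OF p(1)] _ b[OF pT] c0 _ u1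
          contu g h(1,2) h(3)[OF pT] sub dw _ \<open>0 < \<epsilon>\<close> wp _ max' Mp])
      show "S \<subseteq> D" using DT by simp
      show "\<forall>\<^sub>F t in at_right 0. p + t *\<^sub>R b p \<in> S"
        using normal[OF pT]
        by (intro C1_Hoelder_boundary_portion_normal(3)[OF \<open>open S\<close> portion pT])
          (simp add: normal_component_def inner_commute)
      show "\<forall>\<^sub>F x in nhds p. x \<in> S \<longrightarrow> c x \<le> C" using ball by eventually_elim (blast intro: Cp)
      show "continuous_on UNIV G" unfolding G_def by (rule continuous_on_barrier_grad)
      show "0 < b p \<bullet> G p - C * w p" using drift[OF QD[OF p(1)]] \<open>0 < \<beta>\<close> by simp
    qed
  qed
qed

section \<open>The strong maximum principle up to the degenerate boundary\<close>

theorem theorem4p10: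
  fixes S :: "(real^'n) set"
    and a :: "real^'n \<Rightarrow> real^'n^'n"
    and b :: "real^'n \<Rightarrow> real^'n"
    and c u :: "real^'n \<Rightarrow> real"
    and \<alpha> :: real
  assumes "open S" and "connected S"
    and "\<And>x. x \<in> S \<Longrightarrow> nonneg_definite_symmetric (a x)"
    and a_locally_bounded: "locally_bounded_on S a"
    and "\<And>x. x \<in> S \<Longrightarrow> lsc_envelope S (\<lambda>y. smallest_eigenvalue (a y)) x > 0"
    and "\<And>x. x \<in> degenerate_boundary S a \<Longrightarrow> normal_component S b x > 0"
    and "\<And>x. x \<in> S \<Longrightarrow> c x \<ge> 0"
    and "\<And>x. x \<in> degenerate_boundary S a \<Longrightarrow> c x \<ge> 0"
    and "locally_bounded_on S b"
    and "locally_bounded_on (domain_with_boundary S a) c"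
    and "\<And>x. x \<in> degenerate_boundary S a \<Longrightarrow>
           continuous (at x within domain_with_boundary S a) b"
    and "0 < \<alpha>" and "\<alpha> < 1"
    and "C1_Hoelder_boundary_portion \<alpha> S (degenerate_boundary S a)"
    and "u \<in> C2s S a"
    and "\<And>x. x \<in> S \<Longrightarrow> elliptic_op a b c u x \<le> 0"
  shows "((\<forall>x\<in>domain_with_boundary S a. c x = 0) \<and>
          (\<exists>x\<in>domain_with_boundary S a. \<forall>y\<in>domain_with_boundary S a. u y \<le> u x)
          \<longrightarrow> u constant_on S) \<and>
         ((\<forall>x\<in>domain_with_boundary S a. c x \<ge> 0) \<and>
          (\<exists>x\<in>domain_with_boundary S a. u x \<ge> 0 \<and>
             (\<forall>y\<in>domain_with_boundary S a. u y \<le> u x))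
          \<longrightarrow> u constant_on S)"
proof -
  let ?D = "domain_with_boundary S a"
  have S_subset: "S \<subseteq> ?D" by (simp add: domain_with_boundary_def)
  have loc_c: "locally_bounded_on S c"
    unfolding locally_bounded_on_def
  proof
    fix x assume "x \<in> S"
    then obtain r where "r > 0" "bounded (c ` (?D \<inter> ball x r))"
      using assms(10) S_subset unfolding locally_bounded_on_def by blast
    moreover have "c ` (S \<inter> ball x r) \<subseteq> c ` (?D \<inter> ball x r)" using S_subset by blast
    ultimately show "\<exists>r>0. bounded (c ` (S \<inter> ball x r))" using bounded_subset by blast
  qed
  have constant_if: "u constant_on S"
    if x0: "x\<^sub>0 \<in> ?D" and max: "\<And>y. y \<in> ?D \<Longrightarrow> u y \<le> u x\<^sub>0"
      and cM: "\<And>x. x \<in> S \<Longrightarrow> 0 \<le> c x * u x\<^sub>0" for x\<^sub>0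
  proof -
    \<comment> \<open>passing to \<open>u - M\<close> for the maximum \<open>M\<close> of \<open>u\<close> costs the term \<open>c M\<close>, which is nonnegative in both cases\<close>
    have sub: "c x * (u x - u x\<^sub>0) \<le> trace (a x ** hessian u x) + b x \<bullet> grad u x" if "x \<in> S" for x
      using assms(16)[OF that] cM[OF that] unfolding elliptic_op_def right_diff_distrib by linarith
    have "\<exists>z\<in>S. u z = u x\<^sub>0"
    proof (rule ccontr)
      assume no_interior: "\<not> (\<exists>z\<in>S. u z = u x\<^sub>0)"
      then have "x\<^sub>0 \<in> degenerate_boundary S a"
        using x0 unfolding domain_with_boundary_def by blast
      moreover have "u x \<noteq> u x\<^sub>0" if "x \<in> S" for x using no_interior that by blast
      ultimately show False
        by (intro no_maximum_on_degenerate_boundary[OF assms(1,3,6,7,10,11,14,15) sub max _ _ refl])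
    qed
    then obtain z where "z \<in> S" "u z = u x\<^sub>0" by blast
    have u: "C2_on S u" using assms(15) unfolding C2s_def by blast
    have le: "u x \<le> u x\<^sub>0" if "x \<in> S" for x using max[OF subsetD[OF S_subset that]] .
    have "u x = u x\<^sub>0" if "x \<in> S" for x
      by (rule interior_strong_maximum_principle[OF assms(1-4,9) loc_c assms(5,7) u sub le
            \<open>z \<in> S\<close> \<open>u z = u x\<^sub>0\<close> that])
    then show ?thesis unfolding constant_on_def by blast
  qed
  show ?thesis
  proof (intro conjI impI; elim conjE bexE)
    fix x assume zero: "\<forall>x\<in>?D. c x = 0" and x: "x \<in> ?D" and max: "\<forall>y\<in>?D. u y \<le> u x"
    show "u constant_on S"
      by (rule constant_if[OF x]) (use max zero S_subset in auto)
  next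
    fix x assume x: "x \<in> ?D" "0 \<le> u x" and max: "\<forall>y\<in>?D. u y \<le> u x"
    show "u constant_on S"
      by (rule constant_if[OF x(1)]) (use max x(2) assms(7) in auto)
  qed
qed

end
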